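(* Let $\mu,\nu$ be Borel probability measures on $[0,1)$, both dyadically doubling (there is $C_0\ge1$ with $\mu(\hat I)\le C_0\mu(I)$ and $\nu(\hat I)\le C_0\nu(I)$ for all $I\in\mathcal{D}\setminus\{[0,1)\}$), and assume that for some $C\geq 1$, $$\sum_{I\in\mathcal{D},\, I\subset J} \alpha^2_{\mu,\nu}(I)\mu(I) \leq C\mu(J) \qquad \text{for all } J\in\mathcal{D}.$$ Then $\mu \in A^{\mathcal{D}}_\infty(\nu)$.
   Context: $\mathcal{D}$ denotes the family of dyadic intervals $[j2^{-k},(j+1)2^{-k})\subset[0,1)$, $k\ge0$; $\hat I$ is the parent of $I$. Wasserstein distance: $\mathbb{W}_1(\nu_1,\nu_2) := \sup_\psi |\int\psi\,d\nu_1 - \int\psi\,d\nu_2|$ over all $1$-Lipschitz $\psi\colon\mathbb{R}\to\mathbb{R}$ supported on $[0,1]$. For an interval $I$, $T_I$ is the increasing affine map taking $\overline I$ onto $[0,1]$, $\mu_I := T_{I\sharp}(\mu|_I)/\mu(I)$, $\nu_I := T_{I\sharp}(\nu|_I)/\nu(I)$ (zero if the normalising mass vanishes), and $\alpha_{\mu,\nu}(I) := \mathbb{W}_1(\mu_I,\nu_I)$. The dyadic class $A_\infty^{\mathcal{D}}(\nu)$: $\mu\in A^{\mathcal{D}}_\infty(\nu)$ if there exist constants $C',\delta>0$ such that $\mu(E)/\mu(I)\le C'(\nu(E)/\nu(I))^\delta$ for all $I\in\mathcal{D}$ and all Borel $E\subset I$. *)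

theory Defs
  imports "HOL-Probability.Probability"
begin

definition dyadic :: "nat \<Rightarrow> nat \<Rightarrow> real set" where
  "dyadic k j = {real j / 2^k ..< (real j + 1) / 2^k}"

text \<open>Index set of the dyadic family D, parametrised injectively by (k, j).\<close>
definition dyadic_idx :: "(nat \<times> nat) set" where
  "dyadic_idx = {(k, j). j < 2^k}"

text \<open>Integral of psi against the normalised blow-up mu_I of M to the interval I = [a,b):
  (1/M(I)) * integral over I of psi(T_I x) dM(x), with T_I x = (x-a)/(b-a).
  If M(I) = 0 this is 0 (division by zero gives zero), matching the zero measure.\<close>
definition blowup_int :: "real measure \<Rightarrow> real \<Rightarrow> real \<Rightarrow> (real \<Rightarrow> real) \<Rightarrow> real" where
  "blowup_int M a b \<psi> =
     (1 / measure M {a..<b}) * (\<integral>x. indicator {a..<b} x * \<psi> ((x - a) / (b - a)) \<partial>M)"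

definition W1_test :: "(real \<Rightarrow> real) set" where
  "W1_test = {\<psi>. lipschitz_on 1 UNIV \<psi> \<and> (\<forall>x. x \<notin> {0..1} \<longrightarrow> \<psi> x = 0)}"

definition alpha_coef :: "real measure \<Rightarrow> real measure \<Rightarrow> real \<Rightarrow> real \<Rightarrow> real" where
  "alpha_coef M N a b =
     Sup {\<bar>blowup_int M a b \<psi> - blowup_int N a b \<psi>\<bar> | \<psi>. \<psi> \<in> W1_test}"

definition alpha_dyadic :: "real measure \<Rightarrow> real measure \<Rightarrow> nat \<Rightarrow> nat \<Rightarrow> real" where
  "alpha_dyadic M N k j = alpha_coef M N (real j / 2^k) ((real j + 1) / 2^k)"

text \<open>Dyadic doubling: mu(parent I) \<le> C0 mu(I) for all I in D other than [0,1).
  The parent of dyadic (Suc k) j is dyadic k (j div 2).\<close>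
definition dyadic_doubling :: "real measure \<Rightarrow> real \<Rightarrow> bool" where
  "dyadic_doubling M C0 \<longleftrightarrow>
     (\<forall>k j. j < 2^(Suc k) \<longrightarrow>
        measure M (dyadic k (j div 2)) \<le> C0 * measure M (dyadic (Suc k) j))"

definition dyadic_A_infty :: "real measure \<Rightarrow> real measure \<Rightarrow> bool" where
  "dyadic_A_infty M N \<longleftrightarrow>
     (\<exists>C' \<delta>. C' > 0 \<and> \<delta> > 0 \<and>
       (\<forall>(k, j) \<in> dyadic_idx. \<forall>E \<in> sets borel. E \<subseteq> dyadic k j \<longrightarrow>
          measure M E / measure M (dyadic k j)
            \<le> C' * (measure N E / measure N (dyadic k j)) powr \<delta>))"

end

theory Submission
  imports Defs
begin

text \<open>
  Write \<open>T\<close> for the affine map of a dyadic interval \<open>I\<close> onto the unit interval and \<open>m(I)\<close> for the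
  integral of the tent function \<open>tent \<circ> T\<close>, which doubling makes comparable to the mass of \<open>I\<close>.
  The half-scale tents of the children of \<open>I\<close> are admissible test functions on \<open>I\<close>, so the ratios
  \<open>m(I')/m(I)\<close> for \<open>\<mu>\<close> and \<open>\<nu>\<close> differ by \<open>O(\<alpha>(I))\<close>.
  Indicator functions are not admissible, but \<open>1 - t\<close> minus its copy on the left half
  is exactly the tent, and likewise for \<open>t\<close> and the right half. Hence the difference between
  \<open>\<mu>\<close> and \<open>\<nu>\<close> of the quotient (integral of \<open>1 - T\<close>) / \<open>m(I)\<close> satisfies a recursion along
  left children with error \<open>O(\<alpha>(I))\<close>; since masses decay geometrically along this chain, squaring and summing
  transfers the Carleson condition from \<open>\<alpha>\<close> to these differences, hence to
  \<open>\<Delta>(I) = \<mu>(I\<^sub>l)/\<mu>(I) - \<nu>(I\<^sub>l)/\<nu>(I)\<close>, where \<open>I\<^sub>l\<close> is the left child.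

  A Bellman function then turns the Carleson condition for \<open>\<Delta>\<close> into a reverse Hoelder inequality:
  for a small exponent \<open>c\<close>, the sum of \<open>\<mu>(I) (\<mu>(I)/\<nu>(I))\<^sup>c\<close> over the descendants \<open>I\<close> of \<open>J\<close> of a fixed
  generation is bounded by a constant times \<open>\<mu>(J) (\<mu>(J)/\<nu>(J))\<^sup>c\<close>.
  Splitting these descendants according to the size of \<open>\<mu>(I)/\<nu>(I)\<close> and optimising the threshold
  gives the \<open>A\<^sub>\<infinity>\<close> bound for open sets, and outer regularity of \<open>\<nu>\<close> for Borel sets.
\<close>

section \<open>Dyadic trees\<close>

lemma mem_dyadic_iff: "x \<in> dyadic k j \<longleftrightarrow> 0 \<le> 2^k * x - real j \<and> 2^k * x - real j < 1"
  unfolding dyadic_def by (auto simp: field_simps)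

lemma dyadic_split: "dyadic k j = dyadic (Suc k) (2*j) \<union> dyadic (Suc k) (Suc (2*j))"
  by (auto simp: mem_dyadic_iff)

lemma dyadic_children_disjoint: "dyadic (Suc k) (2*j) \<inter> dyadic (Suc k) (Suc (2*j)) = {}"
  by (auto simp: mem_dyadic_iff)

lemma dyadic_nonempty: "dyadic k j \<noteq> {}"
proof -
  have "real j / 2^k \<in> dyadic k j" by (simp add: mem_dyadic_iff)
  then show ?thesis by blast
qed

lemma dyadic_eq_if_inter:
  assumes "x \<in> dyadic k i" "x \<in> dyadic k j"
  shows "i = j"
  using assms by (auto simp: mem_dyadic_iff)

lemma dyadic_0_0: "dyadic 0 0 = {0..<1}"
  by (simp add: dyadic_def)

lemma sets_dyadic [measurable, simp]: "dyadic k j \<in> sets borel"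
  by (simp add: dyadic_def)

lemma child_index_less:
  assumes "j < 2^k"
  shows "2*j < 2^Suc k" "Suc (2*j) < 2^Suc k"
  using assms by auto

section \<open>Sums over finite dyadic subtrees and over their last generation\<close>

primrec tree_sum :: "(nat \<Rightarrow> nat \<Rightarrow> real) \<Rightarrow> nat \<Rightarrow> nat \<Rightarrow> nat \<Rightarrow> real" where
  "tree_sum f 0 k j = f k j"
| "tree_sum f (Suc n) k j =
     f k j + tree_sum f n (Suc k) (2*j) + tree_sum f n (Suc k) (Suc (2*j))"

primrec leaf_sum :: "(nat \<Rightarrow> nat \<Rightarrow> real) \<Rightarrow> nat \<Rightarrow> nat \<Rightarrow> nat \<Rightarrow> real" where
  "leaf_sum f 0 k j = f k j"
| "leaf_sum f (Suc n) k j = leaf_sum f n (Suc k) (2*j) + leaf_sum f n (Suc k) (Suc (2*j))"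

text \<open>The index set underlying \<open>tree_sum\<close>: it links the recursive sums to the
  unordered infinite sum of the Carleson hypothesis.\<close>

primrec nodes :: "nat \<Rightarrow> nat \<Rightarrow> nat \<Rightarrow> (nat \<times> nat) set" where
  "nodes 0 k j = {(k, j)}"
| "nodes (Suc n) k j = insert (k, j) (nodes n (Suc k) (2*j) \<union> nodes n (Suc k) (Suc (2*j)))"

lemma finite_nodes: "finite (nodes n k j)"
  by (induction n arbitrary: k j) auto

lemma nodesD:
  assumes "(k', j') \<in> nodes n k j"
  shows "k \<le> k'" "dyadic k' j' \<subseteq> dyadic k j"
proof -
  have "k \<le> k' \<and> dyadic k' j' \<subseteq> dyadic k j"
    using assms
  proof (induction n arbitrary: k j)
    case (Suc n)
    then show ?case
      using dyadic_split[of k j] by fastforce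
  qed auto
  then show "k \<le> k'" "dyadic k' j' \<subseteq> dyadic k j" by auto
qed

lemma nodes_index_less:
  assumes "j < 2^k" "(k', j') \<in> nodes n k j"
  shows "j' < 2^k'"
  using assms
proof (induction n arbitrary: k j)
  case (Suc n)
  then consider "k' = k" "j' = j" | "(k', j') \<in> nodes n (Suc k) (2*j)"
    | "(k', j') \<in> nodes n (Suc k) (Suc (2*j))" by auto
  then show ?case
    using Suc.IH child_index_less[OF Suc.prems(1)] Suc.prems(1) by cases blast+
qed auto

text \<open>No node is counted twice: the root is the only node of its generation, and a node common
  to both subtrees would be a nonempty interval inside two disjoint children.\<close>

lemma tree_sum_eq_sum_nodes: "tree_sum f n k j = (\<Sum>(k', j')\<in>nodes n k j. f k' j')"
proof (induction n arbitrary: k j)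
  case (Suc n)
  have 1: "(k, j) \<notin> nodes n (Suc k) (2*j) \<union> nodes n (Suc k) (Suc (2*j))"
    using nodesD(1) by fastforce
  have 2: "nodes n (Suc k) (2*j) \<inter> nodes n (Suc k) (Suc (2*j)) = {}"
  proof (rule ccontr)
    assume "nodes n (Suc k) (2*j) \<inter> nodes n (Suc k) (Suc (2*j)) \<noteq> {}"
    then obtain k' j' where "(k', j') \<in> nodes n (Suc k) (2*j)" "(k', j') \<in> nodes n (Suc k) (Suc (2*j))"
      by auto
    then show False
      using nodesD(2) dyadic_children_disjoint[of k j] dyadic_nonempty[of k' j'] by blast
  qed
  show ?case
    using 1 2 Suc by (simp add: finite_nodes sum.union_disjoint)
qed auto

lemma tree_sum_mono:
  assumes "\<And>k j. j < 2^k \<Longrightarrow> f k j \<le> g k j" "j < 2^k"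
  shows "tree_sum f n k j \<le> tree_sum g n k j"
  using assms(2)
proof (induction n arbitrary: k j)
  case (Suc n)
  show ?case
    using assms(1)[OF Suc.prems] Suc.IH[OF child_index_less(1)[OF Suc.prems]]
      Suc.IH[OF child_index_less(2)[OF Suc.prems]] by simp
qed (use assms in auto)

lemma leaf_sum_mono:
  assumes "\<And>k j. j < 2^k \<Longrightarrow> f k j \<le> g k j" "j < 2^k"
  shows "leaf_sum f n k j \<le> leaf_sum g n k j"
  using assms(2)
proof (induction n arbitrary: k j)
  case (Suc n)
  show ?case
    using Suc.IH[OF child_index_less(1)[OF Suc.prems]]
      Suc.IH[OF child_index_less(2)[OF Suc.prems]] by simp
qed (use assms in auto)

lemma tree_sum_add: "tree_sum (\<lambda>k j. f k j + g k j) n k j = tree_sum f n k j + tree_sum g n k j"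
  by (induction n arbitrary: k j) auto

lemma tree_sum_cmult: "tree_sum (\<lambda>k j. c * f k j) n k j = c * tree_sum f n k j"
  by (induction n arbitrary: k j) (auto simp: algebra_simps)

lemma leaf_sum_add: "leaf_sum (\<lambda>k j. f k j + g k j) n k j = leaf_sum f n k j + leaf_sum g n k j"
  by (induction n arbitrary: k j) auto

lemma leaf_sum_cmult: "leaf_sum (\<lambda>k j. c * f k j) n k j = c * leaf_sum f n k j"
  by (induction n arbitrary: k j) (auto simp: algebra_simps)

lemma leaf_sum_additive:
  assumes "\<And>k j. f k j = f (Suc k) (2*j) + f (Suc k) (Suc (2*j))"
  shows "leaf_sum f n k j = f k j"
  by (induction n arbitrary: k j) (auto simp: assms[symmetric])

text \<open>Peels off the last generation where the definition peels off the root.\<close>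

lemma tree_sum_Suc_leaf: "tree_sum f (Suc n) k j = tree_sum f n k j + leaf_sum f (Suc n) k j"
proof (induction n arbitrary: k j)
  case (Suc n)
  have "tree_sum f (Suc (Suc n)) k j =
      f k j + (tree_sum f n (Suc k) (2*j) + leaf_sum f (Suc n) (Suc k) (2*j))
            + (tree_sum f n (Suc k) (Suc (2*j)) + leaf_sum f (Suc n) (Suc k) (Suc (2*j)))"
    unfolding tree_sum.simps(2)[of f "Suc n"] Suc.IH ..
  then show ?case by simp
qed auto

lemma tree_sum_nonneg:
  assumes "\<And>k j. f k j \<ge> 0"
  shows "tree_sum f n k j \<ge> 0"
  by (induction n arbitrary: k j) (auto intro!: add_nonneg_nonneg assms)

text \<open>Distinct parents have distinct \<open>d\<close>-th children, so the shifted sum is part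
  of the sum one generation deeper; nonnegativity lets the siblings be dropped.\<close>

lemma tree_sum_child_le:
  assumes "\<And>k j. f k j \<ge> 0" "d \<le> 1"
  shows "f k j + tree_sum (\<lambda>k j. f (Suc k) (2*j+d)) n k j \<le> tree_sum f (Suc n) k j"
proof -
  have c: "f (Suc k) (2*j+d) \<le> f (Suc k) (2*j) + f (Suc k) (Suc (2*j))" for k j
    using assms(1)[of "Suc k" "2*j"] assms(1)[of "Suc k" "Suc (2*j)"] assms(2)
    by (cases "d = 0") (auto simp: le_Suc_eq)
  show ?thesis
  proof (induction n arbitrary: k j)
    case 0
    show ?case using c[of k j] by simp
  next
    case (Suc n)
    show ?case
      using Suc.IH[of "Suc k" "2*j"] Suc.IH[of "Suc k" "Suc (2*j)"] c[of k j]
      unfolding tree_sum.simps(2)[of _ "Suc n"] tree_sum.simps(2)[of "\<lambda>k j. f (Suc k) (2*j+d)"]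
      by linarith
  qed
qed

text \<open>Every family is summable in \<open>ennreal\<close>, so a finite subtree contributes at
  most the full sum. Later estimates work at finite depth \<open>n\<close> with constants
  independent of \<open>n\<close>.\<close>

lemma tree_sum_le_of_infsum:
  assumes "\<And>k j. f k j \<ge> 0" "j < 2^k" "c \<ge> 0"
    and "(\<Sum>\<^sub>\<infinity>(k', j') \<in> {(k', j') \<in> dyadic_idx. dyadic k' j' \<subseteq> dyadic k j}. ennreal (f k' j'))
           \<le> ennreal c"
  shows "tree_sum f n k j \<le> c"
proof -
  let ?A = "{(k', j') \<in> dyadic_idx. dyadic k' j' \<subseteq> dyadic k j}"
  have sub: "nodes n k j \<subseteq> ?A"
    using nodesD(2)[of _ _ n k j] nodes_index_less[OF assms(2), of _ _ n]
    by (auto simp: dyadic_idx_def subset_iff)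
  have "ennreal (tree_sum f n k j) = (\<Sum>x\<in>nodes n k j. ennreal (case x of (k', j') \<Rightarrow> f k' j'))"
    unfolding tree_sum_eq_sum_nodes
    by (rule sum_ennreal[symmetric]) (auto intro: assms)
  also have "\<dots> = (\<Sum>(k', j')\<in>nodes n k j. ennreal (f k' j'))"
    by (rule sum.cong) auto
  also have "\<dots> \<le> (\<Sum>\<^sub>\<infinity>(k', j') \<in> ?A. ennreal (f k' j'))"
    unfolding infsum_finite[OF finite_nodes, symmetric] using sub
    by (intro infsum_mono_neutral nonneg_summable_on_complete) auto
  also have "\<dots> \<le> ennreal c" by fact
  finally show ?thesis
    using assms(3) by (simp add: ennreal_le_iff)
qed

section \<open>Doubling measures\<close>

locale dyadic_doubling_prob = prob_space M for M :: "real measure" +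
  fixes C0 :: real
  assumes sets_M [measurable_cong]: "sets M = sets borel"
    and mass_unit: "measure M {0..<1} = 1"
    and C0_ge_1: "C0 \<ge> 1"
    and doubling: "dyadic_doubling M C0"
begin

abbreviation mass :: "nat \<Rightarrow> nat \<Rightarrow> real" where
  "mass k j \<equiv> measure M (dyadic k j)"

lemma space_M [simp]: "space M = UNIV"
  using sets_eq_imp_space_eq[OF sets_M] by simp

lemma mass_split: "mass k j = mass (Suc k) (2*j) + mass (Suc k) (Suc (2*j))"
  using dyadic_split[of k j] dyadic_children_disjoint[of k j]
  by (simp add: finite_measure_Union sets_M)

lemma mass_le_child:
  assumes "j < 2^k"
  shows "mass k j \<le> C0 * mass (Suc k) (2*j)" "mass k j \<le> C0 * mass (Suc k) (Suc (2*j))"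
  using doubling child_index_less[OF assms] unfolding dyadic_doubling_def
  by (metis nonzero_mult_div_cancel_left zero_neq_numeral, metis div2_Suc_Suc even_Suc_div_two even_mult_iff even_numeral nonzero_mult_div_cancel_left zero_neq_numeral)

text \<open>Doubling passes the positive mass of the unit interval down to all descendants, so
  quotients by their masses never take the default value of division by zero.\<close>

lemma mass_pos:
  assumes "j < 2^k"
  shows "mass k j > 0"
  using assms
proof (induction k arbitrary: j)
  case 0
  then show ?case using mass_unit by (simp add: dyadic_0_0)
next
  case (Suc k)
  have "j div 2 < 2^k" using Suc.prems by auto
  with Suc.IH have "0 < mass k (j div 2)" by blast
  also have "\<dots> \<le> C0 * mass (Suc k) j"
    using doubling Suc.prems unfolding dyadic_doubling_def by blast
  finally show ?case
    using C0_ge_1 by (simp add: zero_less_mult_iff)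
qed

text \<open>The sibling keeps at least the fraction \<open>1/C0\<close> of the mass; this is the
  source of geometric decay along a chain of children.\<close>

lemma mass_child_le:
  assumes "j < 2^k" "d \<le> 1"
  shows "mass (Suc k) (2*j+d) \<le> (1 - 1/C0) * mass k j"
proof -
  have "mass k j / C0 \<le> mass (Suc k) (2*j)" "mass k j / C0 \<le> mass (Suc k) (Suc (2*j))"
    using mass_le_child[OF assms(1)] C0_ge_1 by (auto simp: field_simps)
  then show ?thesis
    using mass_split[of k j] assms(2) by (cases "d = 0") (auto simp: left_diff_distrib le_Suc_eq)
qed

end

lemma (in dyadic_doubling_prob) leaf_sum_mass: "leaf_sum mass n k j = mass k j"
  by (rule leaf_sum_additive) (rule mass_split)

text \<open>The recursive term on the right is a part of the sum on the left one generation deeper, so it is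
  absorbed up to a single generation of leaves, whose total is at most \<open>K\<close> times the mass.\<close>

lemma (in dyadic_doubling_prob) tree_sum_le_of_child_recursion:
  assumes nonneg: "\<And>k j. Q k j \<ge> 0"
    and d: "d \<le> 1" and \<rho>: "0 \<le> \<rho>" "\<rho> < 1"
    and step: "\<And>k j. j < 2^k \<Longrightarrow> Q k j \<le> a k j + \<rho> * Q (Suc k) (2*j+d)"
    and bound: "\<And>k j. j < 2^k \<Longrightarrow> Q k j \<le> K * mass k j"
    and j: "j < 2^k"
  shows "(1 - \<rho>) * tree_sum Q n k j \<le> tree_sum a n k j + \<rho> * K * mass k j"
proof -
  let ?Qc = "\<lambda>k j. Q (Suc k) (2*j+d)"
  have "tree_sum Q n k j \<le> tree_sum (\<lambda>k j. a k j + \<rho> * ?Qc k j) n k j"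
    by (rule tree_sum_mono[OF _ j]) (rule step)
  also have "\<dots> = tree_sum a n k j + \<rho> * tree_sum ?Qc n k j"
    by (simp only: tree_sum_add tree_sum_cmult)
  finally have 1: "tree_sum Q n k j \<le> tree_sum a n k j + \<rho> * tree_sum ?Qc n k j" .
  have "leaf_sum Q (Suc n) k j \<le> leaf_sum (\<lambda>k j. K * mass k j) (Suc n) k j"
    by (rule leaf_sum_mono[OF _ j]) (rule bound)
  also have "\<dots> = K * mass k j"
    by (simp only: leaf_sum_cmult leaf_sum_mass)
  finally have "tree_sum ?Qc n k j \<le> tree_sum Q n k j + K * mass k j"
    using tree_sum_child_le[of Q d k j n] nonneg d nonneg[of k j] tree_sum_Suc_leaf[of Q n k j]
    by fastforce
  then have "\<rho> * tree_sum ?Qc n k j \<le> \<rho> * (tree_sum Q n k j + K * mass k j)"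
    using \<rho> by (intro mult_left_mono)
  with 1 show ?thesis
    by (simp add: algebra_simps)
qed

section \<open>The Bellman function\<close>

text \<open>Young's inequality for \<open>z\<close> and \<open>1\<close> with weights
  \<open>c\<close> and \<open>1-c\<close>.\<close>

lemma powr_le_Bernoulli:
  fixes z c :: real
  assumes "z > 0" "0 \<le> c" "c \<le> 1"
  shows "z powr c \<le> 1 + c * (z - 1)"
  using Youngs_inequality_0[of c "1-c" z 1] assms by (simp add: algebra_simps)

text \<open>For \<open>A\<close> between \<open>0\<close> and \<open>M\<close> the slope
  \<open>4*M - 2*A\<close> is at least \<open>2*M\<close>, and the quadratic term makes the function
  strictly concave; one step down the tree uses both gains.\<close>

definition bellman :: "real \<Rightarrow> real \<Rightarrow> real" where
  "bellman M A = 1 + 4 * M * A - A\<^sup>2"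

lemma bellman_bounds:
  assumes "0 \<le> A" "A \<le> M"
  shows "1 \<le> bellman M A" "bellman M A \<le> 1 + 4 * M\<^sup>2"
proof -
  have "A * A \<le> M * A" "M * A \<le> M * M" "0 \<le> M * A"
    using assms by (auto intro: mult_right_mono mult_left_mono)
  moreover have "0 \<le> A * A" by simp
  ultimately show "1 \<le> bellman M A" "bellman M A \<le> 1 + 4 * M\<^sup>2"
    unfolding bellman_def power2_eq_square mult.assoc by linarith+
qed

text \<open>\<open>p\<close>, \<open>q\<close> are the fractions of \<open>\<mu>\<close>- and \<open>\<nu>\<close>-mass in the left child, and \<open>A\<close>, \<open>A1\<close>, \<open>A2\<close> the
  normalised Carleson sums of the parent and of the children. The first-order term
  \<open>c (p - q) (A1 - A2)\<close> is absorbed half by the growth of the Bellman function in the \<open>(p - q)\<^sup>2\<close> part of \<open>A\<close>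
  and half by its strict concavity.\<close>

lemma bellman_step:
  fixes p q \<kappa> M c A1 A2 :: real
  assumes \<kappa>: "0 < \<kappa>" and p: "\<kappa> \<le> p" "p \<le> 1 - \<kappa>" and q: "\<kappa> \<le> q" "q \<le> 1 - \<kappa>"
    and A: "0 \<le> A1" "A1 \<le> M" "0 \<le> A2" "A2 \<le> M"
    and M: "1 \<le> M" and A_eq: "A = (p - q)\<^sup>2 + p * A1 + (1 - p) * A2" and AM: "A \<le> M"
    and c: "c = \<kappa> / (16 * M)"
  shows "p * (p/q) powr c * bellman M A1 + (1-p) * ((1-p)/(1-q)) powr c * bellman M A2
           \<le> bellman M A"
proof -
  define d a U V where "d = p - q" and "a = A1 - A2" and "U = bellman M A1" and "V = bellman M A2"
  have \<kappa>2: "\<kappa> \<le> 1/2" using p by linarith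
  have c01: "0 < c" "c \<le> 1" using \<kappa> \<kappa>2 M by (auto simp: c field_simps)
  have pq: "0 < p" "p < 1" "0 < q" "q < 1" using \<kappa> p q by auto
  have UV: "0 \<le> U" "0 \<le> V" "U \<le> 5 * M\<^sup>2" "V \<le> 5 * M\<^sup>2"
    using bellman_bounds[OF A(1,2)] bellman_bounds[OF A(3,4)] M one_le_power[OF M, of 2]
    unfolding U_def V_def by linarith+
  have 1: "p * (p/q) powr c * U \<le> p * (1 + c * (p/q - 1)) * U"
    using powr_le_Bernoulli[of "p/q" c] c01 pq UV by (intro mult_right_mono mult_left_mono) auto
  have 2: "(1-p) * ((1-p)/(1-q)) powr c * V \<le> (1-p) * (1 + c * ((1-p)/(1-q) - 1)) * V"
    using powr_le_Bernoulli[of "(1-p)/(1-q)" c] c01 pq UV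
    by (intro mult_right_mono mult_left_mono) auto
  \<comment> \<open>The linearised sum is the average of \<open>U\<close> and \<open>V\<close>, plus
    a first-order term in \<open>d\<close> that would vanish for \<open>U = V\<close>, plus a
    second-order term.\<close>
  have eq: "p * (1 + c * (p/q - 1)) * U + (1-p) * (1 + c * ((1-p)/(1-q) - 1)) * V
      = p * U + (1-p) * V + c * (d * (U - V)) + c * (d\<^sup>2 * (U/q + V/(1-q)))"
  proof -
    have "p * (p/q - 1) = d + d\<^sup>2/q" "(1-p) * ((1-p)/(1-q) - 1) = - d + d\<^sup>2/(1-q)"
      using pq by (auto simp: d_def field_simps power2_eq_square)
    moreover have "p * (1 + c * (p/q - 1)) * U = p * U + c * U * (p * (p/q - 1))"
      "(1-p) * (1 + c * ((1-p)/(1-q) - 1)) * V = (1-p) * V + c * V * ((1-p) * ((1-p)/(1-q) - 1))"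
      by (auto simp: algebra_simps)
    ultimately show ?thesis
      by (simp only:) (simp add: distrib_left right_diff_distrib mult_ac)
  qed
  \<comment> \<open>Dividing by \<open>q\<close> and \<open>1-q\<close> costs
    \<open>1/\<kappa>\<close>; the value \<open>c = \<kappa>/(16*M)\<close> brings the second-order
    error down to \<open>(5/8) * (M * d^2)\<close>.\<close>
  have "U / q \<le> 5 * M\<^sup>2 / \<kappa>" "V / (1-q) \<le> 5 * M\<^sup>2 / \<kappa>"
    using UV pq \<kappa> q by (auto intro!: frac_le)
  then have "d\<^sup>2 * (U/q + V/(1-q)) \<le> d\<^sup>2 * (10 * M\<^sup>2 / \<kappa>)"
    by (intro mult_left_mono) auto
  then have "c * (d\<^sup>2 * (U/q + V/(1-q))) \<le> c * (d\<^sup>2 * (10 * M\<^sup>2 / \<kappa>))"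
    using c01 by (simp only: mult_left_mono less_imp_le)
  also have "\<dots> = (5/8) * (M * d\<^sup>2)"
    using M \<kappa> by (simp add: c field_simps power2_eq_square)
  also have "\<dots> \<le> M * d\<^sup>2" using M by simp
  finally have 3: "c * (d\<^sup>2 * (U/q + V/(1-q))) \<le> M * d\<^sup>2" .
  have UmV: "U - V = a * (4 * M - A1 - A2)"
    by (simp add: U_def V_def a_def bellman_def power2_eq_square algebra_simps)
  have 4: "c * (d * (U - V)) \<le> M * d\<^sup>2 + (\<kappa>/2) * a\<^sup>2"
  proof -
    define h where "h = 4 * M - A1 - A2"
    have h: "0 \<le> h" "h \<le> 4 * M" using A unfolding h_def by auto
    \<comment> \<open>AM-GM, with weights chosen so that the first square is exactly half of the available \<open>2 M d\<^sup>2\<close>\<close>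
    have "(2 * M * d - c * h * a)\<^sup>2 \<ge> 0" by simp
    then have "4 * M * (c * (d * (h * a))) \<le> 4 * M * (M * d\<^sup>2) + c\<^sup>2 * h\<^sup>2 * a\<^sup>2"
      by (simp add: power2_eq_square algebra_simps)
    also have "c\<^sup>2 * h\<^sup>2 * a\<^sup>2 \<le> c\<^sup>2 * (4*M)\<^sup>2 * a\<^sup>2"
      using h by (intro mult_right_mono mult_left_mono power_mono) auto
    also have "c\<^sup>2 * (4*M)\<^sup>2 * a\<^sup>2 = (\<kappa>/16 * \<kappa>) * a\<^sup>2"
      using M by (simp add: c field_simps power2_eq_square)
    also have "\<dots> \<le> (4 * M * (\<kappa>/2)) * a\<^sup>2"
    proof (intro mult_right_mono)
      have "\<kappa>/16 * \<kappa> \<le> 1 * \<kappa>" using \<kappa> \<kappa>2 by (intro mult_right_mono) auto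
      also have "\<dots> \<le> (2 * M) * \<kappa>" using \<kappa> M by (intro mult_right_mono) auto
      finally show "\<kappa>/16 * \<kappa> \<le> 4 * M * (\<kappa>/2)" by simp
    qed simp
    finally have "4 * M * (c * (d * (h * a))) \<le> 4 * M * (M * d\<^sup>2 + (\<kappa>/2) * a\<^sup>2)"
      by (simp add: algebra_simps)
    then have "c * (d * (h * a)) \<le> M * d\<^sup>2 + (\<kappa>/2) * a\<^sup>2"
      using M by (simp only: mult_le_cancel_left_pos)
    then show ?thesis unfolding UmV h_def by (simp add: mult_ac)
  qed
  \<comment> \<open>Raising the argument from the average \<open>m\<close> to \<open>m + d^2\<close>
    gains \<open>2 * M * d^2\<close> by the slope. The concavity gap at \<open>m\<close> is exactly
    \<open>p * (1-p) * a^2\<close>, where one of \<open>p\<close>, \<open>1-p\<close> is at least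
    \<open>1/2\<close> and the other at least \<open>\<kappa>\<close>.\<close>
  have 5: "p * U + (1-p) * V + 2 * M * d\<^sup>2 + (\<kappa>/2) * a\<^sup>2 \<le> bellman M A"
  proof -
    define m where "m = p * A1 + (1-p) * A2"
    have A': "A = d\<^sup>2 + m" by (simp add: A_eq d_def m_def)
    have m: "m \<le> M" using AM A' by (smt (verit) zero_le_power2)
    have "bellman M A - bellman M m = d\<^sup>2 * (4 * M - A - m)"
      by (simp add: A' bellman_def power2_eq_square algebra_simps)
    also have "\<dots> \<ge> d\<^sup>2 * (2 * M)"
      using AM m by (intro mult_left_mono) auto
    finally have i: "bellman M A \<ge> bellman M m + 2 * M * d\<^sup>2" by (simp add: mult_ac)
    have ii: "bellman M m - p * U - (1-p) * V = p * (1-p) * a\<^sup>2"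
      by (simp add: m_def U_def V_def a_def bellman_def power2_eq_square algebra_simps)
    have "\<kappa>/2 \<le> p * (1-p)"
    proof (cases "p \<le> 1/2")
      case True
      have "\<kappa> * (1/2) \<le> p * (1-p)" using True p \<kappa> by (intro mult_mono) auto
      then show ?thesis by simp
    next
      case False
      have "(1/2) * \<kappa> \<le> p * (1-p)" using False p \<kappa> by (intro mult_mono) auto
      then show ?thesis by simp
    qed
    then have "(\<kappa>/2) * a\<^sup>2 \<le> p * (1-p) * a\<^sup>2" by (intro mult_right_mono) auto
    with i ii show ?thesis by linarith
  qed
  show ?thesis
    using 1 2 eq 3 4 5 unfolding U_def[symmetric] V_def[symmetric] by linarith
qed

section \<open>Moments on dyadic intervals\<close>

definition tent :: "real \<Rightarrow> real" where
  "tent t = max 0 (min t (1 - t))"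

text \<open>The blow-up integral without its normalisation. In this form the moments of an interval
  and of its children can be added and compared directly.\<close>

definition moment :: "real measure \<Rightarrow> (real \<Rightarrow> real) \<Rightarrow> nat \<Rightarrow> nat \<Rightarrow> real" where
  "moment M f k j = (\<integral>x. indicator (dyadic k j) x * f (2^k * x - real j) \<partial>M)"

lemma continuous_on_tent: "continuous_on UNIV tent"
  unfolding tent_def by (intro continuous_intros)

lemma blowup_int_eq_moment:
  "blowup_int M (real j / 2^k) ((real j + 1) / 2^k) \<psi> = moment M \<psi> k j / measure M (dyadic k j)"
proof -
  have "(x - real j / 2^k) / ((real j + 1) / 2^k - real j / 2^k) = 2^k * x - real j" for x
    by (simp add: field_simps)
  then show ?thesis
    by (simp add: blowup_int_def moment_def dyadic_def)
qed

lemma abs_tent_diff_le: "\<bar>tent s - tent t\<bar> \<le> \<bar>s - t\<bar>"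
  by (simp add: tent_def)

lemma W1_test_tent: "tent \<in> W1_test"
  unfolding W1_test_def
  by (auto simp: dist_real_def abs_tent_diff_le intro!: lipschitz_onI) (auto simp: tent_def)

text \<open>The factor \<open>1/2\<close> offsets the slope \<open>2\<close> of the rescaling;
  \<open>b\<close> selects the left or the right half.\<close>

lemma W1_test_tent_affine:
  fixes b :: real
  assumes "b \<in> {0, 1}"
  shows "(\<lambda>t. (1/2) * tent (2 * t - b)) \<in> W1_test"
proof -
  have "\<bar>(1/2) * tent (2 * s - b) - (1/2) * tent (2 * t - b)\<bar> \<le> \<bar>s - t\<bar>" for s t
    using abs_tent_diff_le[of "2 * s - b" "2 * t - b"] by linarith
  moreover have "tent (2 * t - b) = 0" if "t \<notin> {0..1}" for t
    using that assms by (auto simp: tent_def)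
  ultimately show ?thesis
    unfolding W1_test_def by (auto simp: dist_real_def intro!: lipschitz_onI)
qed

section \<open>Recursions and bounds for the moments of a doubling measure\<close>

context dyadic_doubling_prob
begin

lemma integrable_moment:
  fixes f :: "real \<Rightarrow> real"
  assumes "continuous_on UNIV f"
  shows "integrable M (\<lambda>x. indicator (dyadic k j) x * f (2^k * x - real j))"
proof -
  have "compact (f ` {0..1})"
    using assms by (intro compact_continuous_image continuous_on_subset[OF assms]) auto
  then obtain B where B: "\<And>t. t \<in> {0..1} \<Longrightarrow> norm (f t) \<le> B"
    using compact_imp_bounded bounded_iff by (metis image_eqI)
  have [measurable]: "f \<in> borel_measurable borel"
    using assms by (rule borel_measurable_continuous_onI)
  have "0 \<le> B" using B[of 0] by (smt (verit) norm_ge_zero atLeastAtMost_iff)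
  show ?thesis
  proof (rule integrable_const_bound[where B = B])
    show "AE x in M. norm (indicator (dyadic k j) x * f (2^k * x - real j)) \<le> B"
      using \<open>0 \<le> B\<close> by (intro AE_I2) (auto simp: indicator_def mem_dyadic_iff intro!: B[simplified])
  qed measurable
qed

lemma moment_add:
  assumes "continuous_on UNIV f" "continuous_on UNIV g"
  shows "moment M (\<lambda>t. f t + g t) k j = moment M f k j + moment M g k j"
  unfolding moment_def
  by (subst Bochner_Integration.integral_add[symmetric]) (auto simp: integrable_moment assms distrib_left)

lemma moment_cmult: "moment M (\<lambda>t. c * f t) k j = c * moment M f k j"
  unfolding moment_def by (subst integral_mult_right_zero[symmetric]) (simp add: mult_ac)

lemma moment_one: "moment M (\<lambda>t. 1) k j = mass k j"
  unfolding moment_def by simp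

lemma moment_mono:
  assumes "continuous_on UNIV f" "continuous_on UNIV g" "\<And>t. 0 \<le> t \<Longrightarrow> t < 1 \<Longrightarrow> f t \<le> g t"
  shows "moment M f k j \<le> moment M g k j"
  unfolding moment_def
  by (rule integral_mono[OF integrable_moment[OF assms(1)] integrable_moment[OF assms(2)]])
     (auto simp: indicator_def mem_dyadic_iff intro: assms)

lemma moment_bounds:
  assumes "continuous_on UNIV f" "\<And>t. 0 \<le> t \<Longrightarrow> t < 1 \<Longrightarrow> 0 \<le> f t \<and> f t \<le> 1"
  shows "0 \<le> moment M f k j" "moment M f k j \<le> mass k j"
  using moment_mono[OF _ assms(1), of "\<lambda>t. 0"] moment_mono[OF assms(1), of "\<lambda>t. 1"] assms(2)
  by (auto simp: moment_one moment_def[of M "\<lambda>t. 0"])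

text \<open>The tent vanishes off the unit interval, so the rescaled tent needs no cut-off to the
  child.\<close>

lemma moment_tent_left: "moment M tent (Suc k) (2*j) = moment M (\<lambda>t. tent (2*t)) k j"
  unfolding moment_def
  by (intro Bochner_Integration.integral_cong)
     (auto simp: indicator_def mem_dyadic_iff tent_def algebra_simps)

lemma moment_tent_right: "moment M tent (Suc k) (Suc (2*j)) = moment M (\<lambda>t. tent (2*t-1)) k j"
  unfolding moment_def
  by (intro Bochner_Integration.integral_cong)
     (auto simp: indicator_def mem_dyadic_iff tent_def algebra_simps)

text \<open>Pointwise, \<open>(1 - t) - (1 - 2*t) = t\<close> on the left half, while on the right
  half \<open>1 - t\<close> is itself the tent.\<close>

lemma moment_left_step:
  "moment M (\<lambda>t. 1 - t) k j = moment M tent k j + moment M (\<lambda>t. 1 - t) (Suc k) (2*j)"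
proof -
  have c: "continuous_on UNIV (\<lambda>t::real. 1 - t)" by (intro continuous_intros)
  show ?thesis
    unfolding moment_def
    by (subst Bochner_Integration.integral_add[symmetric, OF integrable_moment[OF continuous_on_tent] integrable_moment[OF c]])
       (intro Bochner_Integration.integral_cong;
        auto simp: indicator_def mem_dyadic_iff tent_def algebra_simps)
qed

lemma moment_right_step:
  "moment M (\<lambda>t. t) k j = moment M tent k j + moment M (\<lambda>t. t) (Suc k) (Suc (2*j))"
proof -
  have c: "continuous_on UNIV (\<lambda>t::real. t)" by (intro continuous_intros)
  show ?thesis
    unfolding moment_def
    by (subst Bochner_Integration.integral_add[symmetric, OF integrable_moment[OF continuous_on_tent] integrable_moment[OF c]])
       (intro Bochner_Integration.integral_cong;
        auto simp: indicator_def mem_dyadic_iff tent_def algebra_simps)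
qed

text \<open>Splits the indicator, which is not a test function, into the two functions that obey the
  step relations.\<close>

lemma mass_eq_moments: "mass k j = moment M (\<lambda>t. 1 - t) k j + moment M (\<lambda>t. t) k j"
  by (subst moment_add[symmetric]) (auto simp: moment_one intro!: continuous_intros)

lemma moment_tent_bounds: "0 \<le> moment M tent k j" "moment M tent k j \<le> mass k j"
  using moment_bounds[OF continuous_on_tent] by (auto simp: tent_def)

text \<open>The second quarter of the interval, from \<open>1/4\<close> to \<open>1/2\<close> in
  relative position, is reached by two doubling steps, and the tent is at least \<open>1/4\<close>
  there.\<close>

lemma moment_tent_ge:
  assumes "j < 2^k"
  shows "mass k j \<le> 4 * C0\<^sup>2 * moment M tent k j"
proof -
  let ?I = "dyadic (Suc (Suc k)) (Suc (2*(2*j)))"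
  have "mass k j \<le> C0 * mass (Suc k) (2*j)"
    using assms by (rule mass_le_child)
  also have "\<dots> \<le> C0 * (C0 * measure M ?I)"
    using C0_ge_1 mass_le_child(2)[OF child_index_less(1)[OF assms]] by (intro mult_left_mono) auto
  finally have 1: "mass k j \<le> C0\<^sup>2 * measure M ?I" by (simp add: power2_eq_square)
  have "(\<integral>x. indicator ?I x / 4 \<partial>M) \<le> moment M tent k j"
    unfolding moment_def
  proof (rule integral_mono[OF _ integrable_moment[OF continuous_on_tent]])
    show "integrable M (\<lambda>x. indicator ?I x / 4 :: real)" by (intro integrable_divide integrable_real_indicator) (auto simp: sets_M emeasure_eq_measure)
    show "indicator ?I x / 4 \<le> indicator (dyadic k j) x * tent (2^k * x - real j)" for x
      by (auto simp: indicator_def mem_dyadic_iff tent_def algebra_simps)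
  qed
  then have "measure M ?I \<le> 4 * moment M tent k j" by simp
  then have "C0\<^sup>2 * measure M ?I \<le> C0\<^sup>2 * (4 * moment M tent k j)" by (intro mult_left_mono) auto
  with 1 show ?thesis by simp
qed

lemma abs_moment_test_le:
  assumes "\<psi> \<in> W1_test"
  shows "\<bar>moment M \<psi> k j\<bar> \<le> 2 * mass k j"
proof -
  have lip: "1-lipschitz_on UNIV \<psi>" and supp: "\<And>x. x \<notin> {0..1} \<Longrightarrow> \<psi> x = 0"
    using assms by (auto simp: W1_test_def)
  have cont: "continuous_on UNIV \<psi>" using lip by (rule lipschitz_on_continuous_on)
  \<comment> \<open>The test function vanishes at \<open>-1\<close>, which has distance less than
    \<open>2\<close> from \<open>t\<close>.\<close>
  have "\<bar>\<psi> t\<bar> \<le> 2" if "0 \<le> t" "t < 1" for t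
    using lipschitz_onD[OF lip, of t "-1"] supp[of "-1"] that by (auto simp: dist_real_def)
  then have "moment M (\<lambda>t. -2 * 1) k j \<le> moment M \<psi> k j" "moment M \<psi> k j \<le> moment M (\<lambda>t. 2 * 1) k j"
    by (intro moment_mono cont continuous_on_const; fastforce simp: abs_le_iff)+
  then show ?thesis
    unfolding moment_cmult moment_one by auto
qed

end

section \<open>From the Wasserstein coefficients to the splitting ratios\<close>

lemma abs_mult_add_mult_le:
  fixes u r g s :: real
  assumes "0 \<le> r" "0 \<le> g"
  shows "\<bar>u * r + g * s\<bar> \<le> \<bar>u\<bar> * r + g * \<bar>s\<bar>"
  using abs_triangle_ineq[of "u * r" "g * s"] assms by (simp add: abs_mult)

locale dyadic_doubling_pair =
  mu: dyadic_doubling_prob M C0 + nu: dyadic_doubling_prob N C0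
  for M N :: "real measure" and C0 :: real
begin

abbreviation \<alpha> :: "nat \<Rightarrow> nat \<Rightarrow> real" where
  "\<alpha> \<equiv> alpha_dyadic M N"

definition B :: real where
  "B = 4 * C0\<^sup>2"

lemma B_ge_1: "1 \<le> B"
  using one_le_power[OF mu.C0_ge_1, of 2] by (simp add: B_def)

text \<open>A real \<open>Sup\<close> bounds its set only if the set is bounded above; estimating
  each blow-up integral by \<open>2\<close> supplies the bound \<open>4\<close>.\<close>

lemma test_diff_le_alpha:
  assumes "\<psi> \<in> W1_test" "j < 2^k"
  shows "\<bar>moment M \<psi> k j / mu.mass k j - moment N \<psi> k j / nu.mass k j\<bar> \<le> \<alpha> k j"
proof -
  have "\<bar>moment M \<phi> k j / mu.mass k j - moment N \<phi> k j / nu.mass k j\<bar> \<le> 4" if "\<phi> \<in> W1_test" for \<phi>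
  proof -
    have "\<bar>moment M \<phi> k j / mu.mass k j\<bar> \<le> 2" "\<bar>moment N \<phi> k j / nu.mass k j\<bar> \<le> 2"
      using mu.abs_moment_test_le[OF that] nu.abs_moment_test_le[OF that]
        mu.mass_pos[OF assms(2)] nu.mass_pos[OF assms(2)]
      by (auto simp: field_simps)
    then show ?thesis by linarith
  qed
  then have "bdd_above {\<bar>blowup_int M (real j / 2^k) ((real j + 1) / 2^k) \<psi>
      - blowup_int N (real j / 2^k) ((real j + 1) / 2^k) \<psi>\<bar> | \<psi>. \<psi> \<in> W1_test}"
    unfolding blowup_int_eq_moment by (intro bdd_aboveI[of _ 4]) auto
  then show ?thesis
    unfolding alpha_dyadic_def alpha_coef_def
    by (rule cSup_upper[rotated]) (use assms(1) in \<open>auto simp: blowup_int_eq_moment\<close>)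
qed

lemma alpha_nonneg:
  assumes "j < 2^k"
  shows "0 \<le> \<alpha> k j"
  using test_diff_le_alpha[OF W1_test_tent assms] by linarith

lemma tent_mass_ge:
  assumes "j < 2^k"
  shows "mu.mass k j \<le> B * moment M tent k j" "nu.mass k j \<le> B * moment N tent k j"
  using mu.moment_tent_ge[OF assms] nu.moment_tent_ge[OF assms] by (auto simp: B_def)

lemma tent_pos:
  assumes "j < 2^k"
  shows "0 < moment M tent k j" "0 < moment N tent k j"
  using tent_mass_ge[OF assms] mu.mass_pos[OF assms] nu.mass_pos[OF assms] B_ge_1
  by (smt (verit) mult_nonneg_nonpos)+

text \<open>Divided by the mass, numerator and denominator become blow-up integrals of test
  functions, the numerator with a factor \<open>2\<close> because only the half-scale tent is
  admissible. The denominators are at least \<open>1/B\<close>.\<close>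

lemma tent_child_ratio:
  assumes "d \<le> 1" "j < 2^k"
  shows "\<bar>moment M tent (Suc k) (2*j+d) / moment M tent k j
           - moment N tent (Suc k) (2*j+d) / moment N tent k j\<bar> \<le> 3 * B\<^sup>2 * \<alpha> k j"
proof -
  define b b' where "b = moment M tent k j / mu.mass k j" and "b' = moment N tent k j / nu.mass k j"
  define a a' where "a = moment M tent (Suc k) (2*j+d) / mu.mass k j"
    and "a' = moment N tent (Suc k) (2*j+d) / nu.mass k j"
  note pos = mu.mass_pos[OF assms(2)] nu.mass_pos[OF assms(2)]
  note \<alpha> = alpha_nonneg[OF assms(2)]
  have b: "\<bar>b - b'\<bar> \<le> \<alpha> k j"
    unfolding b_def b'_def by (rule test_diff_le_alpha[OF W1_test_tent assms(2)])
  have "moment M tent (Suc k) (2*j+d) = 2 * moment M (\<lambda>t. (1/2) * tent (2*t - real d)) k j"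
    "moment N tent (Suc k) (2*j+d) = 2 * moment N (\<lambda>t. (1/2) * tent (2*t - real d)) k j"
    using assms(1) unfolding mu.moment_cmult nu.moment_cmult
    by (auto simp: le_Suc_eq mu.moment_tent_left nu.moment_tent_left mu.moment_tent_right nu.moment_tent_right)
  moreover have "real d \<in> {0, 1}" using assms(1) by (auto simp: le_Suc_eq)
  moreover note test_diff_le_alpha[OF W1_test_tent_affine assms(2), of "real d"]
  ultimately have a: "\<bar>a - a'\<bar> \<le> 2 * \<alpha> k j"
    unfolding a_def a'_def by (simp only: times_divide_eq_right[symmetric] True_implies_equals)
  have b1: "1 \<le> B * b" "1 \<le> B * b'"
    using tent_mass_ge[OF assms(2)] pos unfolding b_def b'_def by (auto simp: field_simps)
  have bpos: "0 < b" "0 < b'"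
    using tent_pos[OF assms(2)] pos unfolding b_def b'_def by auto
  have inv: "inverse b \<le> B" "inverse b' \<le> B"
    using b1 bpos by (auto simp: field_simps)
  have "nu.mass (Suc k) (2*j+d) \<le> nu.mass k j"
    using nu.mass_split[of k j] assms(1) by (auto simp: le_Suc_eq)
  then have a': "0 \<le> a'" "a' \<le> 1"
    using nu.moment_tent_bounds[of "Suc k" "2*j+d"] pos unfolding a'_def by (auto simp: field_simps)
  \<comment> \<open>Changes the numerator first, then the denominator; the error factors
    \<open>2 * B\<close> and \<open>B * B\<close> add up to at most \<open>3 * B^2\<close>.\<close>
  have "a / b - a' / b' = (a - a') * inverse b + a' * inverse b * inverse b' * (b' - b)"
    using bpos by (simp add: field_simps)
  also have "\<bar>\<dots>\<bar> \<le> \<bar>a - a'\<bar> * inverse b + a' * inverse b * inverse b' * \<bar>b - b'\<bar>"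
    using bpos a' by (intro order_trans[OF abs_triangle_ineq]) (simp add: abs_mult abs_minus_commute)
  also have "\<dots> \<le> (2 * \<alpha> k j) * B + 1 * B * B * \<alpha> k j"
    using a a' b inv bpos \<alpha> B_ge_1 by (intro add_mono mult_mono mult_nonneg_nonneg) auto
  also have "\<dots> \<le> 2 * \<alpha> k j * (B * B) + 1 * B * B * \<alpha> k j"
    using B_ge_1 \<alpha> mult_mono[of 1 B B B] by (intro add_mono mult_left_mono) auto
  finally have "\<bar>a / b - a' / b'\<bar> \<le> 3 * B\<^sup>2 * \<alpha> k j"
    by (simp add: power2_eq_square algebra_simps)
  moreover have "a / b = moment M tent (Suc k) (2*j+d) / moment M tent k j"
    "a' / b' = moment N tent (Suc k) (2*j+d) / moment N tent k j"
    using pos unfolding a_def b_def a'_def b'_def by auto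
  ultimately show ?thesis by simp
qed

text \<open>Dividing by the tent moment rather than the mass turns a step relation into
  \<open>1\<close> plus a multiple of the child's ratio; the \<open>1\<close> is common to both
  measures and cancels.\<close>

definition defect :: "(real \<Rightarrow> real) \<Rightarrow> nat \<Rightarrow> nat \<Rightarrow> real" where
  "defect f k j = \<bar>moment M f k j / moment M tent k j - moment N f k j / moment N tent k j\<bar>"

text \<open>The normalisation makes one step down cost a factor \<open>1 - 1/C0\<close> (the loss of mass), although
  the tent moments themselves need not decrease from a parent to its child.\<close>

definition energy :: "(real \<Rightarrow> real) \<Rightarrow> nat \<Rightarrow> nat \<Rightarrow> real" where
  "energy f k j = (defect f k j * moment M tent k j)\<^sup>2 / mu.mass k j"

lemma moment_ratio_bounds:
  assumes "continuous_on UNIV f" "\<And>t. 0 \<le> t \<Longrightarrow> t < 1 \<Longrightarrow> 0 \<le> f t \<and> f t \<le> 1" "j < 2^k"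
  shows "0 \<le> moment M f k j / moment M tent k j" "moment M f k j / moment M tent k j \<le> B"
    "0 \<le> moment N f k j / moment N tent k j" "moment N f k j / moment N tent k j \<le> B"
  using mu.moment_bounds[OF assms(1,2), of k j] nu.moment_bounds[OF assms(1,2), of k j]
    tent_pos[OF assms(3)] tent_mass_ge[OF assms(3)]
  by (auto simp: divide_le_eq)

text \<open>Both ratios lie between \<open>0\<close> and \<open>B\<close>, hence so does the defect.
  This crude bound controls the leaves in the absorption argument.\<close>

lemma energy_le_mass:
  assumes "continuous_on UNIV f" "\<And>t. 0 \<le> t \<Longrightarrow> t < 1 \<Longrightarrow> 0 \<le> f t \<and> f t \<le> 1" "j < 2^k"
  shows "energy f k j \<le> B\<^sup>2 * mu.mass k j"
proof -
  have "defect f k j \<le> B" "0 \<le> defect f k j"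
    using moment_ratio_bounds[OF assms] unfolding defect_def by linarith+
  then have "(defect f k j * moment M tent k j)\<^sup>2 \<le> (B * mu.mass k j)\<^sup>2"
    using mu.moment_tent_bounds[of k j] B_ge_1 by (intro power_mono mult_mono) auto
  then show ?thesis
    using mu.mass_pos[OF assms(3)]
    by (simp add: energy_def divide_le_eq power2_eq_square mult_ac)
qed

lemma defect_sq_le_energy:
  assumes "j < 2^k"
  shows "(defect f k j)\<^sup>2 * mu.mass k j \<le> B\<^sup>2 * energy f k j"
proof -
  have "(defect f k j)\<^sup>2 * (mu.mass k j)\<^sup>2 \<le> (defect f k j)\<^sup>2 * (B * moment M tent k j)\<^sup>2"
    using tent_mass_ge(1)[OF assms] by (intro mult_left_mono power_mono) auto
  then show ?thesis
    using mu.mass_pos[OF assms] by (simp add: energy_def field_simps power2_eq_square)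
qed

lemma energy_nonneg: "0 \<le> energy f k j"
  by (simp add: energy_def)

text \<open>The parent's defect is at most the child's defect times the ratio of tent moments, up to
  the error from \<open>tent_child_ratio\<close>. The squares contract because
  \<open>(1 + 1/C0) * (1 - 1/C0) = 1 - 1/C0^2\<close>.\<close>

lemma energy_step:
  assumes f: "continuous_on UNIV f" "\<And>t. 0 \<le> t \<Longrightarrow> t < 1 \<Longrightarrow> 0 \<le> f t \<and> f t \<le> 1"
    and stepM: "moment M f k j = moment M tent k j + moment M f (Suc k) (2*j+d)"
    and stepN: "moment N f k j = moment N tent k j + moment N f (Suc k) (2*j+d)"
    and d: "d \<le> 1" and j: "j < 2^k"
  shows "energy f k j \<le> (1 + C0) * 9 * B^6 * ((\<alpha> k j)\<^sup>2 * mu.mass k j)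
           + (1 - 1 / C0\<^sup>2) * energy f (Suc k) (2*j+d)"
proof -
  have jc: "2*j+d < 2^Suc k" using d j by auto
  let ?m = "moment M tent k j" and ?n = "moment N tent k j"
  let ?mc = "moment M tent (Suc k) (2*j+d)" and ?nc = "moment N tent (Suc k) (2*j+d)"
  define g h where "g = moment M f (Suc k) (2*j+d) / ?mc" and "h = moment N f (Suc k) (2*j+d) / ?nc"
  define r s where "r = ?mc / ?m" and "s = ?nc / ?n"
  note pos = tent_pos[OF j] tent_pos[OF jc]
  note \<alpha> = alpha_nonneg[OF j]
  have h: "0 \<le> h" "h \<le> B" using moment_ratio_bounds[OF f jc] by (auto simp only: h_def)
  have r: "0 \<le> r" using pos by (simp add: r_def)
  have "moment M f k j / ?m = 1 + g * r" "moment N f k j / ?n = 1 + h * s"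
    using pos unfolding stepM stepN g_def h_def r_def s_def by (simp_all add: add_divide_distrib)
  then have "defect f k j = \<bar>(g - h) * r + h * (r - s)\<bar>"
    by (simp add: defect_def algebra_simps)
  also have "\<dots> \<le> \<bar>g - h\<bar> * r + h * \<bar>r - s\<bar>"
    using r h by (intro abs_mult_add_mult_le)
  also have "\<dots> \<le> \<bar>g - h\<bar> * r + B * (3 * B\<^sup>2 * \<alpha> k j)"
    using tent_child_ratio[OF d j] h B_ge_1 unfolding r_def s_def
    by (intro add_left_mono mult_mono) simp_all
  finally have "defect f k j \<le> defect f (Suc k) (2*j+d) * (?mc / ?m) + B * (3 * B\<^sup>2 * \<alpha> k j)"
    unfolding g_def h_def r_def defect_def .
  then have "defect f k j * ?m \<le> (defect f (Suc k) (2*j+d) * (?mc / ?m) + B * (3 * B\<^sup>2 * \<alpha> k j)) * ?m"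
    using pos by (intro mult_right_mono) auto
  also have "\<dots> = defect f (Suc k) (2*j+d) * ?mc + 3 * B^3 * \<alpha> k j * ?m"
    using pos by (simp add: distrib_right power2_eq_square power3_eq_cube)
  also have "\<dots> \<le> defect f (Suc k) (2*j+d) * ?mc + 3 * B^3 * \<alpha> k j * mu.mass k j"
    using B_ge_1 \<alpha> mu.moment_tent_bounds(2)[of k j]
    by (intro add_left_mono mult_left_mono mult_nonneg_nonneg) auto
  finally have "defect f k j * ?m \<le> defect f (Suc k) (2*j+d) * ?mc + 3 * B^3 * \<alpha> k j * mu.mass k j" .
  define x y where "x = defect f (Suc k) (2*j+d) * ?mc" and "y = 3 * B^3 * \<alpha> k j * mu.mass k j"
  have dxy: "defect f k j * ?m \<le> x + y"
    unfolding x_def y_def by fact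
  have C0: "0 < C0" using mu.C0_ge_1 by linarith
  have "(defect f k j * ?m)\<^sup>2 \<le> (x + y)\<^sup>2"
    using dxy pos by (intro power_mono mult_nonneg_nonneg) (simp_all add: defect_def)
  \<comment> \<open>Young's inequality with parameter \<open>1/C0\<close>, small enough for its
    factor to be outweighed by the loss of mass in the child.\<close>
  also have "\<dots> \<le> (1 + 1/C0) * x\<^sup>2 + (1 + C0) * y\<^sup>2"
  proof -
    have "0 \<le> (x - C0 * y)\<^sup>2 / C0" using C0 by simp
    also have "\<dots> = x\<^sup>2 / C0 + C0 * y\<^sup>2 - 2 * x * y"
      using C0 by (simp add: field_simps power2_eq_square)
    finally show ?thesis by (simp add: power2_eq_square algebra_simps)
  qed
  finally have "energy f k j \<le> ((1 + 1/C0) * x\<^sup>2 + (1 + C0) * y\<^sup>2) / mu.mass k j"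
    using mu.mass_pos[OF j] unfolding energy_def by (intro divide_right_mono) auto
  also have "\<dots> = (1 + 1/C0) * (x\<^sup>2 / mu.mass k j) + (1 + C0) * (y\<^sup>2 / mu.mass k j)"
    by (simp add: add_divide_distrib)
  finally have 2: "energy f k j \<le> (1 + 1/C0) * (x\<^sup>2 / mu.mass k j) + (1 + C0) * (y\<^sup>2 / mu.mass k j)" .
  have 3: "y\<^sup>2 / mu.mass k j = 9 * B^6 * ((\<alpha> k j)\<^sup>2 * mu.mass k j)"
    using mu.mass_pos[OF j] unfolding y_def power_mult_distrib power_mult[symmetric]
    by (simp add: power2_eq_square)
  have "x\<^sup>2 * mu.mass (Suc k) (2*j+d) \<le> x\<^sup>2 * ((1 - 1/C0) * mu.mass k j)"
    using mu.mass_child_le[OF j d] by (intro mult_left_mono) auto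
  then have "x\<^sup>2 / mu.mass k j \<le> (1 - 1/C0) * (x\<^sup>2 / mu.mass (Suc k) (2*j+d))"
    using mu.mass_pos[OF j] mu.mass_pos[OF jc]
    by (simp add: pos_divide_le_eq pos_le_divide_eq mult_ac)
  also have "x\<^sup>2 / mu.mass (Suc k) (2*j+d) = energy f (Suc k) (2*j+d)"
    by (simp add: energy_def x_def)
  finally have "(1 + 1/C0) * (x\<^sup>2 / mu.mass k j) \<le> (1 + 1/C0) * ((1 - 1/C0) * energy f (Suc k) (2*j+d))"
    using C0 by (intro mult_left_mono) auto
  also have "\<dots> = (1 - 1 / C0\<^sup>2) * energy f (Suc k) (2*j+d)"
    by (simp add: power2_eq_square algebra_simps add_divide_distrib)
  finally show ?thesis
    using 2 unfolding 3 by (simp only: mult_ac)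
qed

text \<open>Absorption with contraction factor \<open>1 - 1/C0^2\<close>; dividing by its complement
  \<open>1/C0^2\<close> produces the factor \<open>C0^2\<close>.\<close>

lemma energy_carleson:
  assumes f: "continuous_on UNIV f" "\<And>t. 0 \<le> t \<Longrightarrow> t < 1 \<Longrightarrow> 0 \<le> f t \<and> f t \<le> 1"
    and stepM: "\<And>k j. moment M f k j = moment M tent k j + moment M f (Suc k) (2*j+d)"
    and stepN: "\<And>k j. moment N f k j = moment N tent k j + moment N f (Suc k) (2*j+d)"
    and d: "d \<le> 1" and j: "j < 2^k"
    and carleson: "\<And>n k j. j < 2^k \<Longrightarrow>
      tree_sum (\<lambda>k j. (\<alpha> k j)\<^sup>2 * mu.mass k j) n k j \<le> C * mu.mass k j"
  shows "tree_sum (energy f) n k j \<le> C0\<^sup>2 * ((1 + C0) * 9 * B^6 * C + B\<^sup>2) * mu.mass k j"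
proof -
  let ?K = "(1 + C0) * 9 * B^6"
  have C0: "1 \<le> C0\<^sup>2" using mu.C0_ge_1 by simp
  have K: "0 \<le> ?K" using mu.C0_ge_1 by auto
  have "(1 - (1 - 1/C0\<^sup>2)) * tree_sum (energy f) n k j
      \<le> tree_sum (\<lambda>k j. ?K * ((\<alpha> k j)\<^sup>2 * mu.mass k j)) n k j + (1 - 1/C0\<^sup>2) * B\<^sup>2 * mu.mass k j"
  proof (rule mu.tree_sum_le_of_child_recursion[where d = d])
    show "energy f k j \<le> ?K * ((\<alpha> k j)\<^sup>2 * mu.mass k j) + (1 - 1/C0\<^sup>2) * energy f (Suc k) (2*j+d)"
      if "j < 2^k" for k j
      using f stepM stepN d that by (rule energy_step)
    show "energy f k j \<le> B\<^sup>2 * mu.mass k j" if "j < 2^k" for k j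
      using f that by (rule energy_le_mass)
  qed (use C0 d j energy_nonneg in \<open>auto simp: divide_le_eq_1\<close>)
  also have "\<dots> \<le> ?K * (C * mu.mass k j) + 1 * B\<^sup>2 * mu.mass k j"
    unfolding tree_sum_cmult using C0
    by (intro add_mono mult_left_mono[OF carleson[OF j] K] mult_right_mono) auto
  finally have "tree_sum (energy f) n k j / C0\<^sup>2 \<le> (?K * C + B\<^sup>2) * mu.mass k j"
    by (simp add: algebra_simps)
  moreover have "0 < C0\<^sup>2" using C0 by linarith
  ultimately have "tree_sum (energy f) n k j \<le> (?K * C + B\<^sup>2) * mu.mass k j * C0\<^sup>2"
    by (simp only: pos_divide_le_eq)
  then show ?thesis by (simp add: mult_ac)
qed

section \<open>Carleson condition for the mass fractions of left children\<close>

abbreviation jump :: "nat \<Rightarrow> nat \<Rightarrow> real" where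
  "jump k j \<equiv> mu.mass (Suc k) (2*j) / mu.mass k j - nu.mass (Suc k) (2*j) / nu.mass k j"

text \<open>A mass fraction factors as \<open>S * r / R\<close>: mass over tent moment in the child,
  ratio of the tent moments, and mass over tent moment in the parent, inverted. The outer factors
  are controlled by defects through \<open>mass_eq_moments\<close>, the middle one by
  \<open>tent_child_ratio\<close>.\<close>

lemma jump_le:
  assumes j: "j < 2^k"
  shows "\<bar>jump k j\<bar> \<le> B\<^sup>2 * (defect (\<lambda>t. 1 - t) k j + defect (\<lambda>t. t) k j)
           + B\<^sup>2 * (defect (\<lambda>t. 1 - t) (Suc k) (2*j) + defect (\<lambda>t. t) (Suc k) (2*j))
           + 3 * B^3 * \<alpha> k j"
proof -
  have jc: "2*j < 2^Suc k" using j by simp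
  note pos = tent_pos[OF j] tent_pos[OF jc] mu.mass_pos[OF j] nu.mass_pos[OF j]
    mu.mass_pos[OF jc] nu.mass_pos[OF jc]
  define R R' where "R = mu.mass k j / moment M tent k j" and "R' = nu.mass k j / moment N tent k j"
  define S S' where "S = mu.mass (Suc k) (2*j) / moment M tent (Suc k) (2*j)"
    and "S' = nu.mass (Suc k) (2*j) / moment N tent (Suc k) (2*j)"
  define r r' where "r = moment M tent (Suc k) (2*j) / moment M tent k j"
    and "r' = moment N tent (Suc k) (2*j) / moment N tent k j"
  have p: "mu.mass (Suc k) (2*j) / mu.mass k j = S * r / R" "nu.mass (Suc k) (2*j) / nu.mass k j = S' * r' / R'"
    using pos by (auto simp: R_def R'_def S_def S'_def r_def r'_def)
  have RR: "\<bar>R - R'\<bar> \<le> defect (\<lambda>t. 1 - t) k j + defect (\<lambda>t. t) k j"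
    unfolding R_def R'_def defect_def mu.mass_eq_moments nu.mass_eq_moments add_divide_distrib
    by linarith
  have SS: "\<bar>S - S'\<bar> \<le> defect (\<lambda>t. 1 - t) (Suc k) (2*j) + defect (\<lambda>t. t) (Suc k) (2*j)"
    unfolding S_def S'_def defect_def mu.mass_eq_moments nu.mass_eq_moments add_divide_distrib
    by linarith
  have rr: "\<bar>r - r'\<bar> \<le> 3 * B\<^sup>2 * \<alpha> k j"
    using tent_child_ratio[of 0 j k] j unfolding r_def r'_def by simp
  have R: "1 \<le> R" "1 \<le> R'"
    using mu.moment_tent_bounds[of k j] nu.moment_tent_bounds[of k j] pos
    by (auto simp: R_def R'_def)
  have S: "0 \<le> S'" "S' \<le> B"
    using tent_mass_ge[OF jc] pos by (auto simp: S'_def divide_le_eq)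
  have mc: "mu.mass (Suc k) (2*j) \<le> mu.mass k j" "nu.mass (Suc k) (2*j) \<le> nu.mass k j"
    using mu.mass_split[of k j] nu.mass_split[of k j] by auto
  have r: "0 \<le> r" "r \<le> B" "0 \<le> r'" "r' \<le> B"
    using mu.moment_tent_bounds[of "Suc k" "2*j"] nu.moment_tent_bounds[of "Suc k" "2*j"]
      mc tent_mass_ge[OF j] pos
    by (auto simp: r_def r'_def divide_le_eq)
  have iR: "inverse R \<le> 1" "inverse R' \<le> 1" "0 \<le> inverse R" "0 \<le> inverse R'"
    using R by (auto simp: inverse_le_1_iff)
  \<comment> \<open>Exchanges one factor at a time. The inverses are at most \<open>1\<close>
    because a tent moment never exceeds the mass.\<close>
  have "jump k j = (S - S') * r * inverse R + S' * (r - r') * inverse R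
      + S' * r' * inverse R * inverse R' * (R' - R)"
    unfolding p using R by (simp add: field_simps)
  also have "\<bar>\<dots>\<bar> \<le> \<bar>S - S'\<bar> * r * inverse R + S' * \<bar>r - r'\<bar> * inverse R
      + S' * r' * inverse R * inverse R' * \<bar>R - R'\<bar>"
    using S r iR
    by (intro order_trans[OF abs_triangle_ineq] add_mono) (simp_all add: abs_mult abs_minus_commute)
  also have "\<dots> \<le> \<bar>S - S'\<bar> * B * 1 + B * \<bar>r - r'\<bar> * 1 + B * B * 1 * 1 * \<bar>R - R'\<bar>"
    using S r iR B_ge_1 by (intro add_mono mult_mono mult_nonneg_nonneg) auto
  also have "\<dots> \<le> B\<^sup>2 * \<bar>S - S'\<bar> + B * \<bar>r - r'\<bar> + B\<^sup>2 * \<bar>R - R'\<bar>"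
    using mult_right_mono[OF self_le_power[OF B_ge_1, of 2], of "\<bar>S - S'\<bar>"]
    by (simp add: power2_eq_square mult_ac)
  also have "\<dots> \<le> B\<^sup>2 * (defect (\<lambda>t. 1 - t) (Suc k) (2*j) + defect (\<lambda>t. t) (Suc k) (2*j))
      + B * (3 * B\<^sup>2 * \<alpha> k j) + B\<^sup>2 * (defect (\<lambda>t. 1 - t) k j + defect (\<lambda>t. t) k j)"
    using RR SS rr B_ge_1 by (intro add_mono mult_left_mono) auto
  also have "B * (3 * B\<^sup>2 * \<alpha> k j) = 3 * B^3 * \<alpha> k j"
    by (simp add: power2_eq_square power3_eq_cube)
  finally show ?thesis by simp
qed

lemma jump_sq_le:
  assumes j: "j < 2^k"
  shows "(jump k j)\<^sup>2 * mu.mass k j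
    \<le> 5 * C0 * B^6 * (energy (\<lambda>t. 1 - t) k j + energy (\<lambda>t. t) k j
        + (energy (\<lambda>t. 1 - t) (Suc k) (2*j) + energy (\<lambda>t. t) (Suc k) (2*j)))
      + 45 * B^6 * ((\<alpha> k j)\<^sup>2 * mu.mass k j)"
proof -
  have jc: "2*j < 2^Suc k" using j by simp
  define a b c d where "a = defect (\<lambda>t. 1 - t) k j" and "b = defect (\<lambda>t. t) k j"
    and "c = defect (\<lambda>t. 1 - t) (Suc k) (2*j)" and "d = defect (\<lambda>t. t) (Suc k) (2*j)"
  define e where "e = 3 * B * \<alpha> k j"
  have "\<bar>jump k j\<bar> \<le> B\<^sup>2 * (a + b + c + d + e)"
    using jump_le[OF j] unfolding a_def b_def c_def d_def e_def
    by (simp add: power2_eq_square power3_eq_cube algebra_simps)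
  then have "\<bar>jump k j\<bar>\<^sup>2 \<le> (B\<^sup>2 * (a + b + c + d + e))\<^sup>2"
    by (intro power_mono) auto
  also have "\<dots> = B^4 * (a + b + c + d + e)\<^sup>2"
    by (simp add: power_mult_distrib)
  also have "\<dots> \<le> B^4 * (5 * (a\<^sup>2 + b\<^sup>2 + c\<^sup>2 + d\<^sup>2 + e\<^sup>2))"
  proof (intro mult_left_mono)
    \<comment> \<open>Cauchy-Schwarz for five summands: the ten squared differences are exactly the
      gap.\<close>
    have "0 \<le> (a-b)\<^sup>2 + (a-c)\<^sup>2 + (a-d)\<^sup>2 + (a-e)\<^sup>2 + (b-c)\<^sup>2 + (b-d)\<^sup>2 + (b-e)\<^sup>2
        + (c-d)\<^sup>2 + (c-e)\<^sup>2 + (d-e)\<^sup>2" by (intro add_nonneg_nonneg) auto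
    then show "(a + b + c + d + e)\<^sup>2 \<le> 5 * (a\<^sup>2 + b\<^sup>2 + c\<^sup>2 + d\<^sup>2 + e\<^sup>2)"
      by (simp add: power2_eq_square algebra_simps)
  qed auto
  finally have "(jump k j)\<^sup>2 * mu.mass k j \<le> B^4 * (5 * (a\<^sup>2 + b\<^sup>2 + c\<^sup>2 + d\<^sup>2 + e\<^sup>2)) * mu.mass k j"
    using mu.mass_pos[OF j] by (intro mult_right_mono) auto
  also have "\<dots> = 5 * B^4 * (a\<^sup>2 * mu.mass k j + b\<^sup>2 * mu.mass k j + c\<^sup>2 * mu.mass k j
      + d\<^sup>2 * mu.mass k j + 9 * B\<^sup>2 * ((\<alpha> k j)\<^sup>2 * mu.mass k j))"
    unfolding e_def power_mult_distrib by (simp add: algebra_simps)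
  also have "\<dots> \<le> 5 * B^4 * (C0 * (B\<^sup>2 * energy (\<lambda>t. 1 - t) k j) + C0 * (B\<^sup>2 * energy (\<lambda>t. t) k j)
      + C0 * (B\<^sup>2 * energy (\<lambda>t. 1 - t) (Suc k) (2*j)) + C0 * (B\<^sup>2 * energy (\<lambda>t. t) (Suc k) (2*j))
      + 9 * B\<^sup>2 * ((\<alpha> k j)\<^sup>2 * mu.mass k j))"
  proof (intro mult_left_mono add_mono)
    have own: "(defect f k j)\<^sup>2 * mu.mass k j \<le> C0 * (B\<^sup>2 * energy f k j)" for f
      using defect_sq_le_energy[OF j, of f] mult_right_mono[OF mu.C0_ge_1, of "B\<^sup>2 * energy f k j"]
        energy_nonneg[of f k j] by simp
    show "a\<^sup>2 * mu.mass k j \<le> C0 * (B\<^sup>2 * energy (\<lambda>t. 1 - t) k j)" "b\<^sup>2 * mu.mass k j \<le> C0 * (B\<^sup>2 * energy (\<lambda>t. t) k j)"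
      unfolding a_def b_def by (rule own)+
    \<comment> \<open>The child's defect is weighted here by the parent's mass; doubling replaces it
      by the child's mass at the cost of \<open>C0\<close>.\<close>
    have child: "(defect f (Suc k) (2*j))\<^sup>2 * mu.mass k j \<le> C0 * (B\<^sup>2 * energy f (Suc k) (2*j))" for f
    proof -
      have "(defect f (Suc k) (2*j))\<^sup>2 * mu.mass k j
          \<le> (defect f (Suc k) (2*j))\<^sup>2 * (C0 * mu.mass (Suc k) (2*j))"
        using mu.mass_le_child(1)[OF j] by (intro mult_left_mono) auto
      also have "\<dots> = C0 * ((defect f (Suc k) (2*j))\<^sup>2 * mu.mass (Suc k) (2*j))" by simp
      also have "\<dots> \<le> C0 * (B\<^sup>2 * energy f (Suc k) (2*j))"
        using mu.C0_ge_1 by (intro mult_left_mono defect_sq_le_energy[OF jc]) auto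
      finally show ?thesis .
    qed
    show "c\<^sup>2 * mu.mass k j \<le> C0 * (B\<^sup>2 * energy (\<lambda>t. 1 - t) (Suc k) (2*j))"
      "d\<^sup>2 * mu.mass k j \<le> C0 * (B\<^sup>2 * energy (\<lambda>t. t) (Suc k) (2*j))"
      unfolding c_def d_def by (rule child)+
  qed auto
  also have "\<dots> = 5 * C0 * (B^4 * B\<^sup>2) * (energy (\<lambda>t. 1 - t) k j + energy (\<lambda>t. t) k j
        + (energy (\<lambda>t. 1 - t) (Suc k) (2*j) + energy (\<lambda>t. t) (Suc k) (2*j)))
      + 45 * (B^4 * B\<^sup>2) * ((\<alpha> k j)\<^sup>2 * mu.mass k j)"
    by (simp only: distrib_left distrib_right mult_ac)
  finally show ?thesis
    unfolding power_add[symmetric] by simp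
qed

lemma jump_carleson:
  assumes carleson: "\<And>n k j. j < 2^k \<Longrightarrow>
      tree_sum (\<lambda>k j. (\<alpha> k j)\<^sup>2 * mu.mass k j) n k j \<le> C * mu.mass k j"
  shows "\<exists>K\<ge>1. \<forall>n k j. j < 2^k \<longrightarrow>
      tree_sum (\<lambda>k j. (jump k j)\<^sup>2 * mu.mass k j) n k j \<le> K * mu.mass k j"
proof -
  define Q where "Q = (\<lambda>k j. energy (\<lambda>t. 1 - t) k j + energy (\<lambda>t. t) k j)"
  define L where "L = C0\<^sup>2 * ((1 + C0) * 9 * B^6 * C + B\<^sup>2)"
  have Q: "tree_sum Q n k j \<le> 2 * L * mu.mass k j" if j: "j < 2^k" for n k j
  proof -
    \<comment> \<open>The recursion for \<open>1 - t\<close> runs along left children, the one for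
      \<open>t\<close> along right children.\<close>
    have "tree_sum (energy (\<lambda>t. 1 - t)) n k j \<le> L * mu.mass k j"
      unfolding L_def
    proof (rule energy_carleson[where d = 0])
      show "moment M (\<lambda>t. 1 - t) k j = moment M tent k j + moment M (\<lambda>t. 1 - t) (Suc k) (2*j+0)"
        "moment N (\<lambda>t. 1 - t) k j = moment N tent k j + moment N (\<lambda>t. 1 - t) (Suc k) (2*j+0)" for k j
        using mu.moment_left_step[of k j] nu.moment_left_step[of k j] by simp_all
    qed (rule carleson j continuous_intros | assumption | simp)+
    moreover have "tree_sum (energy (\<lambda>t. t)) n k j \<le> L * mu.mass k j"
      unfolding L_def
    proof (rule energy_carleson[where d = 1])
      show "moment M (\<lambda>t. t) k j = moment M tent k j + moment M (\<lambda>t. t) (Suc k) (2*j+1)"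
        "moment N (\<lambda>t. t) k j = moment N tent k j + moment N (\<lambda>t. t) (Suc k) (2*j+1)" for k j
        using mu.moment_right_step[of k j] nu.moment_right_step[of k j] by simp_all
    qed (rule carleson j continuous_intros | assumption | simp)+
    ultimately show ?thesis
      unfolding Q_def tree_sum_add by simp
  qed
  have Q_nonneg: "0 \<le> Q k j" for k j by (simp add: Q_def energy_nonneg)
  define K where "K = 5 * C0 * B^6 * (4 * L) + 45 * B^6 * C"
  have "tree_sum (\<lambda>k j. (jump k j)\<^sup>2 * mu.mass k j) n k j \<le> max 1 K * mu.mass k j" if j: "j < 2^k" for n k j
  proof -
    have "tree_sum (\<lambda>k j. (jump k j)\<^sup>2 * mu.mass k j) n k j
      \<le> tree_sum (\<lambda>k j. 5 * C0 * B^6 * (Q k j + Q (Suc k) (2*j+0)) + 45 * B^6 * ((\<alpha> k j)\<^sup>2 * mu.mass k j)) n k j"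
      by (rule tree_sum_mono[OF _ j]) (unfold Q_def add_0_right, rule jump_sq_le)
    also have "\<dots> = 5 * C0 * B^6 * (tree_sum Q n k j + tree_sum (\<lambda>k j. Q (Suc k) (2*j+0)) n k j)
        + 45 * B^6 * tree_sum (\<lambda>k j. (\<alpha> k j)\<^sup>2 * mu.mass k j) n k j"
      by (simp only: tree_sum_add tree_sum_cmult)
    also have "\<dots> \<le> 5 * C0 * B^6 * (2 * L * mu.mass k j + 2 * L * mu.mass k j) + 45 * B^6 * (C * mu.mass k j)"
    proof (intro add_mono mult_left_mono Q carleson j)
      \<comment> \<open>The energies of left children are part of the sum of depth
        \<open>Suc n\<close>, which obeys the same bound.\<close>
      show "tree_sum (\<lambda>k j. Q (Suc k) (2*j+0)) n k j \<le> 2 * L * mu.mass k j"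
        using tree_sum_child_le[of Q 0 k j n] Q_nonneg Q[OF j, of "Suc n"] Q_nonneg[of k j] by fastforce
    qed (use mu.C0_ge_1 in auto)
    also have "\<dots> = K * mu.mass k j" by (simp add: K_def algebra_simps)
    also have "\<dots> \<le> max 1 K * mu.mass k j" by (intro mult_right_mono) auto
    finally show ?thesis .
  qed
  \<comment> \<open>The maximum with \<open>1\<close> serves the Bellman step, which requires a
    Carleson constant of at least \<open>1\<close>.\<close>
  then show ?thesis by (intro exI[of _ "max 1 K"]) auto
qed

end

section \<open>Reverse Hoelder inequality and conclusion\<close>

definition inner_cover :: "nat \<Rightarrow> real set \<Rightarrow> real set" where
  "inner_cover m U = (\<Union>i\<in>{i. dyadic m i \<subseteq> U}. dyadic m i)"

lemma inner_cover_subset: "inner_cover m U \<subseteq> U"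
  by (auto simp: inner_cover_def)

lemma sets_inner_cover [simp]: "inner_cover m U \<in> sets borel"
  unfolding inner_cover_def by (intro sets.countable_UN') auto

lemma inner_cover_Int_dyadic:
  "inner_cover m U \<inter> dyadic m j = (if dyadic m j \<subseteq> U then dyadic m j else {})"
proof -
  have "dyadic m j \<subseteq> U" if "x \<in> inner_cover m U" "x \<in> dyadic m j" for x
    using that dyadic_eq_if_inter[of x m _ j] unfolding inner_cover_def by blast
  moreover have "dyadic m j \<subseteq> inner_cover m U" if "dyadic m j \<subseteq> U"
    using that unfolding inner_cover_def by blast
  ultimately show ?thesis by auto
qed

lemma inner_cover_mono: "inner_cover m U \<subseteq> inner_cover (Suc m) U"
proof
  fix x assume "x \<in> inner_cover m U"
  then obtain i where i: "dyadic m i \<subseteq> U" "x \<in> dyadic m i" by (auto simp: inner_cover_def)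
  then show "x \<in> inner_cover (Suc m) U"
    using dyadic_split[of m i] unfolding inner_cover_def by blast
qed

text \<open>Once the length \<open>(1/2)^m\<close> is below the radius of a ball around
  \<open>x\<close> inside \<open>U\<close>, the dyadic interval of generation \<open>m\<close>
  containing \<open>x\<close> lies in that ball.\<close>

lemma UN_inner_cover:
  assumes "open U"
  shows "(\<Union>n. inner_cover (k+n) U \<inter> dyadic k j) = U \<inter> dyadic k j"
proof (intro equalityI subsetI)
  fix x assume x: "x \<in> U \<inter> dyadic k j"
  then obtain e where e: "e > 0" "ball x e \<subseteq> U"
    using assms unfolding open_contains_ball by blast
  obtain n where n: "(1/2) ^ n < e"
    using real_arch_pow_inv[OF e(1), of "1/2"] by auto
  define m where "m = k + n"
  have "(1/2) ^ m \<le> (1/2::real) ^ n" unfolding m_def by (intro power_decreasing) auto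
  with n have "(1/2) ^ m < e" by (rule le_less_trans[rotated])
  then have m: "1 < e * 2^m" by (simp add: power_one_over pos_divide_less_eq)
  \<comment> \<open>Dyadic indices are natural numbers, so the floor defining \<open>i\<close> has
    to be nonnegative; membership in \<open>dyadic k j\<close> ensures this.\<close>
  have "0 \<le> 2^k * x" using x by (simp add: mem_dyadic_iff)
  then have "0 \<le> x" using mult_le_cancel_left_pos[of "2^k" 0 x] by simp
  then have "0 \<le> 2^m * x" by simp
  then have nat_floor: "real (nat \<lfloor>2^m * x\<rfloor>) = of_int \<lfloor>2^m * x\<rfloor>" by simp
  define i where "i = nat \<lfloor>2^m * x\<rfloor>"
  have "real i \<le> 2^m * x" "2^m * x < real i + 1"
    unfolding i_def nat_floor by (rule of_int_floor_le real_of_int_floor_add_one_gt)+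
  then have xm: "x \<in> dyadic m i" by (simp add: mem_dyadic_iff)
  have "dyadic m i \<subseteq> ball x e"
  proof
    fix y assume "y \<in> dyadic m i"
    with xm have "\<bar>2^m * x - 2^m * y\<bar> < 1" by (auto simp: mem_dyadic_iff)
    then have "2^m * \<bar>x - y\<bar> < 1" by (simp add: right_diff_distrib[symmetric] abs_mult)
    also note m
    finally have "2^m * \<bar>x - y\<bar> < 2^m * e" by (simp add: mult.commute)
    then show "y \<in> ball x e" by (simp add: dist_real_def)
  qed
  then have "x \<in> inner_cover m U"
    using e xm unfolding inner_cover_def by blast
  then show "x \<in> (\<Union>n. inner_cover (k+n) U \<inter> dyadic k j)"
    using x unfolding m_def by blast
qed (use inner_cover_subset in blast)

context dyadic_doubling_prob
begin

text \<open>Within its own generation each leaf is either entirely covered or disjoint from the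
  cover; additivity over the children does the rest.\<close>

lemma leaf_sum_inner_cover:
  "leaf_sum (\<lambda>k j. if dyadic k j \<subseteq> U then mass k j else 0) n k j
     = measure M (inner_cover (k+n) U \<inter> dyadic k j)"
proof (induction n arbitrary: k j)
  case 0
  show ?case by (simp add: inner_cover_Int_dyadic)
next
  case (Suc n)
  let ?I = "inner_cover (k + Suc n) U"
  have "measure M (?I \<inter> dyadic k j)
      = measure M ((?I \<inter> dyadic (Suc k) (2*j)) \<union> (?I \<inter> dyadic (Suc k) (Suc (2*j))))"
    by (subst dyadic_split) (simp add: Int_Un_distrib)
  also have "\<dots> = measure M (?I \<inter> dyadic (Suc k) (2*j)) + measure M (?I \<inter> dyadic (Suc k) (Suc (2*j)))"
    by (rule finite_measure_Union) (use dyadic_children_disjoint[of k j] in \<open>auto simp: sets_M\<close>)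
  finally show ?case using Suc.IH by simp
qed

lemma leaf_sum_inner_cover_tendsto:
  assumes "open U"
  shows "(\<lambda>n. leaf_sum (\<lambda>k j. if dyadic k j \<subseteq> U then mass k j else 0) n k j)
           \<longlonglongrightarrow> measure M (U \<inter> dyadic k j)"
  unfolding leaf_sum_inner_cover UN_inner_cover[OF assms, symmetric]
proof (rule finite_Lim_measure_incseq)
  show "incseq (\<lambda>n. inner_cover (k+n) U \<inter> dyadic k j)"
    by (rule incseq_SucI) (use inner_cover_mono in auto)
qed (auto simp: sets_M)

lemma outer_regular_measure:
  assumes "E \<in> sets borel" "e > 0"
  shows "\<exists>U. open U \<and> E \<subseteq> U \<and> measure M U \<le> measure M E + e"
proof -
  have "emeasure M E = (INF U \<in> {U. E \<subseteq> U \<and> open U}. emeasure M U)"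
    by (rule outer_regular) (use assms sets_M in auto)
  moreover have "emeasure M E < emeasure M E + ennreal e"
    using assms(2)
    by (simp add: emeasure_eq_measure ennreal_plus[symmetric] ennreal_less_iff del: ennreal_plus)
  ultimately have "(INF U \<in> {U. E \<subseteq> U \<and> open U}. emeasure M U) < emeasure M E + ennreal e"
    by simp
  then obtain U where U: "E \<subseteq> U" "open U" "emeasure M U < emeasure M E + ennreal e"
    unfolding INF_less_iff by auto
  then have "measure M U \<le> measure M E + e"
    using assms(2)
    by (simp add: emeasure_eq_measure ennreal_plus[symmetric] ennreal_less_iff del: ennreal_plus)
  with U show ?thesis by blast
qed

end

section \<open>Reverse Hoelder inequality and splitting at a density threshold\<close>

context dyadic_doubling_pair
begin

lemma reverse_Hoelder_bellman:
  assumes K: "K \<ge> 1" and c: "c = (1 / C0) / (16 * K)"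
    and carleson: "\<And>n k j. j < 2^k \<Longrightarrow>
      tree_sum (\<lambda>k j. (jump k j)\<^sup>2 * mu.mass k j) n k j \<le> K * mu.mass k j"
    and j: "j < 2^k"
  shows "leaf_sum (\<lambda>k j. mu.mass k j * (mu.mass k j / nu.mass k j) powr c) n k j
    \<le> mu.mass k j * (mu.mass k j / nu.mass k j) powr c
        * bellman K (tree_sum (\<lambda>k j. (jump k j)\<^sup>2 * mu.mass k j) n k j / mu.mass k j)"
  using j
proof (induction n arbitrary: k j)
  case 0
  have "0 \<le> (jump k j)\<^sup>2 * mu.mass k j / mu.mass k j" "(jump k j)\<^sup>2 * mu.mass k j / mu.mass k j \<le> K"
    using carleson[OF 0, of 0] mu.mass_pos[OF 0] by auto
  from mult_left_mono[OF bellman_bounds(1)[OF this], of "mu.mass k j * (mu.mass k j / nu.mass k j) powr c"]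
  show ?case by simp
next
  case (Suc n)
  note jc = child_index_less[OF Suc.prems]
  let ?S = "\<lambda>n k j. tree_sum (\<lambda>k j. (jump k j)\<^sup>2 * mu.mass k j) n k j"
  define m m1 m2 where "m = mu.mass k j" and "m1 = mu.mass (Suc k) (2*j)" and "m2 = mu.mass (Suc k) (Suc (2*j))"
  define v v1 v2 where "v = nu.mass k j" and "v1 = nu.mass (Suc k) (2*j)" and "v2 = nu.mass (Suc k) (Suc (2*j))"
  define A A1 A2 where "A = ?S (Suc n) k j / m" and "A1 = ?S n (Suc k) (2*j) / m1"
    and "A2 = ?S n (Suc k) (Suc (2*j)) / m2"
  define p q where "p = m1 / m" and "q = v1 / v"
  have pos: "0 < m" "0 < m1" "0 < m2" "0 < v" "0 < v1" "0 < v2"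
    unfolding m_def m1_def m2_def v_def v1_def v2_def
    using mu.mass_pos nu.mass_pos Suc.prems jc by blast+
  have sum: "m = m1 + m2" "v = v1 + v2"
    unfolding m_def m1_def m2_def v_def v1_def v2_def by (rule mu.mass_split nu.mass_split)+
  have p1: "1 - p = m2 / m" "1 - q = v2 / v"
    unfolding p_def q_def using pos sum by (auto simp: field_simps)
  have C0: "0 < C0" using mu.C0_ge_1 by linarith
  have "m \<le> C0 * m1" "m \<le> C0 * m2" "v \<le> C0 * v1" "v \<le> C0 * v2"
    unfolding m_def m1_def m2_def v_def v1_def v2_def
    using mu.mass_le_child nu.mass_le_child Suc.prems by blast+
  moreover have "1 / C0 \<le> a / b" if "b \<le> C0 * a" "0 < b" for a b
    using that C0 by (simp add: pos_le_divide_eq pos_divide_le_eq mult.commute)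
  ultimately have "1 / C0 \<le> m1 / m" "1 / C0 \<le> m2 / m" "1 / C0 \<le> v1 / v" "1 / C0 \<le> v2 / v"
    using pos by blast+
  then have pq: "1 / C0 \<le> p" "p \<le> 1 - 1 / C0" "1 / C0 \<le> q" "q \<le> 1 - 1 / C0"
    using p1 unfolding p_def q_def by linarith+
  have nonneg: "0 \<le> ?S n' k' j'" for n' k' j' by (rule tree_sum_nonneg) simp
  have A_bounds: "0 \<le> A1" "A1 \<le> K" "0 \<le> A2" "A2 \<le> K" "A \<le> K"
    using nonneg carleson[OF jc(1), of n] carleson[OF jc(2), of n] carleson[OF Suc.prems, of "Suc n"] pos
    unfolding A_def A1_def A2_def m_def[symmetric] m1_def[symmetric] m2_def[symmetric]
    by (auto simp only: pos_divide_le_eq intro!: divide_nonneg_pos)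
  have "A = (jump k j)\<^sup>2 + m1 / m * A1 + m2 / m * A2"
    using pos unfolding A_def A1_def A2_def by (simp add: m_def[symmetric] add_divide_distrib)
  then have A_eq: "A = (p - q)\<^sup>2 + p * A1 + (1 - p) * A2"
    unfolding p1(1) by (simp add: p_def q_def m_def v_def m1_def v1_def)
  have step: "p * (p/q) powr c * bellman K A1 + (1-p) * ((1-p)/(1-q)) powr c * bellman K A2 \<le> bellman K A"
    by (rule bellman_step[OF _ pq A_bounds(1-4) K A_eq A_bounds(5) c]) (use C0 in simp)
  \<comment> \<open>A child's density is the parent's times \<open>p/q\<close> or
    \<open>(1-p)/(1-q)\<close>, so the parent's power factors out and \<open>bellman_step\<close>
    applies.\<close>
  have "m1 / v1 = (p/q) * (m/v)" "m2 / v2 = ((1-p)/(1-q)) * (m/v)"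
    unfolding p1 unfolding p_def q_def using pos by simp_all
  moreover have "0 \<le> p/q" "0 \<le> (1-p)/(1-q)"
    unfolding p1 unfolding p_def q_def using pos by simp_all
  ultimately have r: "(m1/v1) powr c = (p/q) powr c * (m/v) powr c"
    "(m2/v2) powr c = ((1-p)/(1-q)) powr c * (m/v) powr c"
    using pos by (simp_all only: powr_mult)
  have "leaf_sum (\<lambda>k j. mu.mass k j * (mu.mass k j / nu.mass k j) powr c) (Suc n) k j
      \<le> m1 * (m1/v1) powr c * bellman K A1 + m2 * (m2/v2) powr c * bellman K A2"
    using Suc.IH[OF jc(1)] Suc.IH[OF jc(2)]
    unfolding m1_def m2_def v1_def v2_def A1_def A2_def by simp
  also have "\<dots> = m * (m/v) powr c
      * (p * (p/q) powr c * bellman K A1 + (1-p) * ((1-p)/(1-q)) powr c * bellman K A2)"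
  proof -
    have m12: "m1 = m * p" "m2 = m * (1 - p)" unfolding p1 using pos by (simp_all add: p_def)
    show ?thesis unfolding r unfolding m12 by (simp only: distrib_left mult_ac)
  qed
  also have "\<dots> \<le> m * (m/v) powr c * bellman K A"
    using step pos by (intro mult_left_mono) auto
  finally show ?case unfolding m_def v_def A_def .
qed

text \<open>The leaves inside \<open>U\<close> are split by comparing their density with
  \<open>l\<close> times that of the top interval: below the threshold the \<open>M\<close>-mass is
  at most a multiple of the \<open>N\<close>-mass, above it the reverse Hoelder inequality applies.
  Growing depth exhausts \<open>U\<close>.\<close>

lemma open_mass_bound:
  assumes K: "K \<ge> 1" and c: "c = (1 / C0) / (16 * K)"
    and carleson: "\<And>n k j. j < 2^k \<Longrightarrow>
      tree_sum (\<lambda>k j. (jump k j)\<^sup>2 * mu.mass k j) n k j \<le> K * mu.mass k j"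
    and j: "j < 2^k" and U: "open U" and l: "l > 0"
  shows "measure M (U \<inter> dyadic k j) / mu.mass k j
    \<le> 5 * K\<^sup>2 * l powr (- c) + l * (measure N U / nu.mass k j)"
proof -
  define m v where "m = mu.mass k j" and "v = nu.mass k j"
  have mv: "0 < m" "0 < v" using mu.mass_pos[OF j] nu.mass_pos[OF j] by (auto simp: m_def v_def)
  have c0: "0 < c" using mu.C0_ge_1 K by (auto simp: c)
  let ?w = "\<lambda>k j. mu.mass k j * (mu.mass k j / nu.mass k j) powr c"
  let ?hM = "\<lambda>k j. if dyadic k j \<subseteq> U then mu.mass k j else 0"
  let ?hN = "\<lambda>k j. if dyadic k j \<subseteq> U then nu.mass k j else 0"
  have ptw: "?hM k' j' \<le> (l powr (-c) * (v / m) powr c) * ?w k' j' + (l * (m / v)) * ?hN k' j'"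
    if j': "j' < 2^k'" for k' j'
  proof -
    define a b where "a = mu.mass k' j'" and "b = nu.mass k' j'"
    have ab: "0 < a" "0 < b" using mu.mass_pos[OF j'] nu.mass_pos[OF j'] by (auto simp: a_def b_def)
    have n1: "0 \<le> (l powr (-c) * (v / m) powr c) * (a * (a / b) powr c)" using ab by simp
    have n2: "0 \<le> (l * (m / v)) * b" using ab mv l by simp
    have "a \<le> (l powr (-c) * (v / m) powr c) * (a * (a / b) powr c) + (l * (m / v)) * b"
    proof (cases "a \<le> l * (m / v) * b")
      case False
      \<comment> \<open>Chebyshev's argument: above the threshold the relative density divided by
        \<open>l\<close> is at least \<open>1\<close>, so its power \<open>c\<close> may be inserted
        as a factor.\<close>
      have "1 \<le> ((a / b) * (v / m) / l) powr c"
      proof (rule ge_one_powr_ge_zero)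
        show "1 \<le> a / b * (v / m) / l" using False ab mv l by (simp add: field_simps)
      qed (use c0 in simp)
      also have "\<dots> = l powr (-c) * (v / m) powr c * (a / b) powr c"
        using ab mv l by (simp add: powr_divide powr_mult powr_minus field_simps)
      finally have "a * 1 \<le> a * (l powr (-c) * (v / m) powr c * (a / b) powr c)"
        using ab by (intro mult_left_mono) auto
      then show ?thesis using n2 by (simp add: mult_ac)
    qed (use n1 in linarith)
    then show ?thesis
      using n1 unfolding a_def[symmetric] b_def[symmetric] by auto
  qed
  have bound: "leaf_sum ?hM n k j \<le> m * (5 * K\<^sup>2 * l powr (- c) + l * (measure N U / v))" for n
  proof -
    let ?A = "tree_sum (\<lambda>k j. (jump k j)\<^sup>2 * mu.mass k j) n k j / m"
    have "0 \<le> ?A" "?A \<le> K"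
      using tree_sum_nonneg[of "\<lambda>k j. (jump k j)\<^sup>2 * mu.mass k j" n k j] carleson[OF j, of n] mv
      by (simp_all add: pos_divide_le_eq m_def[symmetric])
    from bellman_bounds(2)[OF this] one_le_power[OF K, of 2]
    have bell: "bellman K ?A \<le> 5 * K\<^sup>2" by linarith
    have "leaf_sum ?w n k j \<le> m * (m / v) powr c * bellman K ?A"
      unfolding m_def v_def by (rule reverse_Hoelder_bellman[OF K c carleson j])
    also have "\<dots> \<le> m * (m / v) powr c * (5 * K\<^sup>2)"
      using mv by (intro mult_left_mono bell) auto
    finally have w: "leaf_sum ?w n k j \<le> m * (m / v) powr c * (5 * K\<^sup>2)" .
    have hN: "leaf_sum ?hN n k j \<le> measure N U"
      unfolding nu.leaf_sum_inner_cover using inner_cover_subset[of "k+n" U] U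
      by (intro nu.finite_measure_mono) (auto simp: nu.sets_M)
    have "leaf_sum ?hM n k j
        \<le> leaf_sum (\<lambda>k' j'. (l powr (-c) * (v / m) powr c) * ?w k' j' + (l * (m / v)) * ?hN k' j') n k j"
      by (rule leaf_sum_mono[OF ptw j])
    also have "\<dots> = (l powr (-c) * (v / m) powr c) * leaf_sum ?w n k j + (l * (m / v)) * leaf_sum ?hN n k j"
      by (simp only: leaf_sum_add leaf_sum_cmult)
    also have "\<dots> \<le> (l powr (-c) * (v / m) powr c) * (m * (m / v) powr c * (5 * K\<^sup>2)) + (l * (m / v)) * measure N U"
      using mv l by (intro add_mono mult_left_mono w hN) auto
    \<comment> \<open>The powers of the top interval's density cancel, leaving a constant
      independent of that interval.\<close>
    also have "(v / m) powr c * (m / v) powr c = 1"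
      using mv by (simp add: powr_mult[symmetric])
    then have "(l powr (-c) * (v / m) powr c) * (m * (m / v) powr c * (5 * K\<^sup>2))
        = m * (5 * K\<^sup>2 * l powr (- c))"
      by (simp add: mult_ac) 
    finally show ?thesis by (simp add: algebra_simps)
  qed
  have "measure M (U \<inter> dyadic k j) \<le> m * (5 * K\<^sup>2 * l powr (- c) + l * (measure N U / v))"
    by (rule LIMSEQ_le_const2[OF mu.leaf_sum_inner_cover_tendsto[OF U]]) (use bound in blast)
  then show ?thesis
    using mv unfolding m_def[symmetric] v_def[symmetric] by (simp add: pos_divide_le_eq mult_ac)
qed

lemma borel_mass_bound:
  assumes K: "K \<ge> 1" and c: "c = (1 / C0) / (16 * K)"
    and carleson: "\<And>n k j. j < 2^k \<Longrightarrow>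
      tree_sum (\<lambda>k j. (jump k j)\<^sup>2 * mu.mass k j) n k j \<le> K * mu.mass k j"
    and j: "j < 2^k" and E: "E \<in> sets borel" "E \<subseteq> dyadic k j" and l: "l > 0"
  shows "measure M E / mu.mass k j
    \<le> 5 * K\<^sup>2 * l powr (- c) + l * (measure N E / nu.mass k j)"
proof (rule field_le_epsilon)
  fix e :: real assume e: "e > 0"
  have v: "0 < nu.mass k j" by (rule nu.mass_pos[OF j])
  \<comment> \<open>The excess allowed to the open superset is scaled so that it contributes exactly
    \<open>e\<close> to the final bound.\<close>
  have "0 < e * nu.mass k j / l" using e v l by simp
  from nu.outer_regular_measure[OF E(1) this]
  obtain U where U: "open U" "E \<subseteq> U" "measure N U \<le> measure N E + e * nu.mass k j / l" by blast
  have "measure M E \<le> measure M (U \<inter> dyadic k j)"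
    using U E by (intro mu.finite_measure_mono) (auto simp: mu.sets_M)
  then have "measure M E / mu.mass k j \<le> measure M (U \<inter> dyadic k j) / mu.mass k j"
    by (intro divide_right_mono) auto
  also have "\<dots> \<le> 5 * K\<^sup>2 * l powr (- c) + l * (measure N U / nu.mass k j)"
    by (rule open_mass_bound[OF K c carleson j U(1) l])
  also have "\<dots> \<le> 5 * K\<^sup>2 * l powr (- c) + l * ((measure N E + e * nu.mass k j / l) / nu.mass k j)"
    using U(3) l v by (intro add_left_mono mult_left_mono divide_right_mono) auto
  also have "\<dots> = 5 * K\<^sup>2 * l powr (- c) + l * (measure N E / nu.mass k j) + e"
    using l v by (simp add: add_divide_distrib distrib_left)
  finally show "measure M E / mu.mass k j \<le> \<dots>" .
qed

end

section \<open>Optimising the threshold, and conclusion\<close>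

lemma le_powr_of_all_thresholds:
  fixes s t c L :: real
  assumes "0 < c" "c \<le> 1" "0 < L" "0 \<le> t" "t \<le> 1"
    and bound: "\<And>l. l > 0 \<Longrightarrow> s \<le> L * l powr (- c) + l * t"
  shows "s \<le> (L + 1) * t powr (c/2)"
proof (cases "t = 0")
  case True
  \<comment> \<open>Since \<open>0 powr (c/2) = 0\<close>, the claim reduces to this; the threshold
    chosen below makes \<open>L * l powr (- c)\<close> equal to \<open>s / 2\<close>.\<close>
  have "s \<le> 0"
  proof (rule ccontr)
    assume "\<not> s \<le> 0"
    then have s: "0 < s" by simp
    have "(2 * L / s) powr (1/c) > 0" using s assms by simp
    from bound[OF this] have "s \<le> L * ((2 * L / s) powr (1/c)) powr (- c)" by (simp add: True)
    also have "\<dots> = L * (2 * L / s) powr (- 1)"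
      using assms by (simp add: powr_powr)
    also have "\<dots> = s / 2"
      using s assms by (simp add: powr_minus)
    finally show False using s by simp
  qed
  then show ?thesis using True by simp
next
  case False
  then have t: "0 < t" using assms by simp
  \<comment> \<open>The threshold \<open>t powr (-1/2)\<close> yields the terms
    \<open>L * t powr (c/2)\<close> and \<open>t powr (1/2)\<close>; the second is at most
    \<open>t powr (c/2)\<close> because \<open>t \<le> 1\<close> and
    \<open>c \<le> 1\<close>.\<close>
  have "s \<le> L * (t powr (-1/2)) powr (- c) + t powr (-1/2) * t"
    by (rule bound) (use t in simp)
  also have "(t powr (-1/2)) powr (- c) = t powr (c/2)"
    by (simp add: powr_powr)
  also have "t powr (-1/2) * t = t powr (1/2)"
    using t powr_add[of t "-1/2" 1] by simp
  also have "t powr (1/2) \<le> t powr (c/2)"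
    using t assms by (intro powr_mono') auto
  finally show ?thesis by (simp add: distrib_right)
qed

theorem mainTheorem4:
  fixes \<mu> \<nu> :: "real measure" and C :: real
  assumes "sets \<mu> = sets borel" and "prob_space \<mu>" and "measure \<mu> {0..<1} = 1"
    and "sets \<nu> = sets borel" and "prob_space \<nu>" and "measure \<nu> {0..<1} = 1"
    and "\<exists>C0 \<ge> 1. dyadic_doubling \<mu> C0 \<and> dyadic_doubling \<nu> C0"
    and "C \<ge> 1"
    and "\<forall>(k, j) \<in> dyadic_idx.
           (\<Sum>\<^sub>\<infinity>(k', j') \<in> {(k', j') \<in> dyadic_idx. dyadic k' j' \<subseteq> dyadic k j}.
              ennreal ((alpha_dyadic \<mu> \<nu> k' j')\<^sup>2 * measure \<mu> (dyadic k' j')))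
           \<le> ennreal (C * measure \<mu> (dyadic k j))"
  shows "dyadic_A_infty \<mu> \<nu>"
proof -
  obtain C0 where C0: "C0 \<ge> 1" "dyadic_doubling \<mu> C0" "dyadic_doubling \<nu> C0"
    using assms(7) by blast
  interpret mu: dyadic_doubling_prob \<mu> C0
    using assms C0 by (intro dyadic_doubling_prob.intro dyadic_doubling_prob_axioms.intro)
  interpret nu: dyadic_doubling_prob \<nu> C0
    using assms C0 by (intro dyadic_doubling_prob.intro dyadic_doubling_prob_axioms.intro)
  interpret dyadic_doubling_pair \<mu> \<nu> C0 ..
  have "tree_sum (\<lambda>k j. (\<alpha> k j)\<^sup>2 * mu.mass k j) n k j \<le> C * mu.mass k j" if "j < 2^k" for n k j
    using assms(8,9) that
    by (intro tree_sum_le_of_infsum) (auto simp: dyadic_idx_def)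
  from jump_carleson[OF this] obtain K where K: "K \<ge> 1"
    and jump: "\<And>n k j. j < 2^k \<Longrightarrow>
      tree_sum (\<lambda>k j. (jump k j)\<^sup>2 * mu.mass k j) n k j \<le> K * mu.mass k j"
    by blast
  \<comment> \<open>The exponent of the Bellman step with \<open>\<kappa> = 1/C0\<close> from
    doubling and the Carleson constant \<open>K\<close> of the jumps.\<close>
  define c where "c = (1 / C0) / (16 * K)"
  have "1 \<le> C0 * (16 * K)" using C0(1) K mult_mono[of 1 C0 1 "16 * K"] by auto
  then have c: "0 < c" "c \<le> 1"
    using C0(1) K unfolding c_def by (auto simp: divide_le_eq_1)
  have "measure \<mu> E / mu.mass k j \<le> (5 * K\<^sup>2 + 1) * (measure \<nu> E / nu.mass k j) powr (c/2)"
    if "j < 2^k" "E \<in> sets borel" "E \<subseteq> dyadic k j" for k j E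
  proof (rule le_powr_of_all_thresholds[OF c])
    show "measure \<mu> E / mu.mass k j \<le> 5 * K\<^sup>2 * l powr (- c) + l * (measure \<nu> E / nu.mass k j)"
      if "l > 0" for l
      using borel_mass_bound[OF K c_def jump] that \<open>j < 2^k\<close> \<open>E \<in> sets borel\<close> \<open>E \<subseteq> dyadic k j\<close> by blast
    show "measure \<nu> E / nu.mass k j \<le> 1"
      using nu.finite_measure_mono[OF that(3)] nu.mass_pos[OF that(1)] by (simp add: nu.sets_M)
  qed (use K in auto)
  moreover have "5 * K\<^sup>2 + 1 > 0" by (simp add: add_nonneg_pos)
  ultimately show ?thesis
    unfolding dyadic_A_infty_def dyadic_idx_def using c(1)
    by (intro exI[of _ "5 * K\<^sup>2 + 1"] exI[of _ "c/2"]) auto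
qed

end
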